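(* There exists a degree-$4$ multivariate polynomial $R:\mathbb{R}^6\to\mathbb{R}$ with positive coefficients such that the following holds. Let $(\tilde A,\tilde B,\tilde C,\tilde D)$ be a stable balanced system, and let $\tilde\sigma_1,\tilde\sigma_{k+1},\epsilon,U,Q_E,Q_U$ and the reduced system $(\hat A,\hat B,\hat C,\hat D)$ be as defined in the context. Given any $\rho>0$ with $\{z\in\mathbb{C}\mid \mathrm{Re}(z)=0\}\cap\sigma_\rho(\tilde A)=\emptyset$, the transfer functions $\tilde G(z)=\tilde D+\tilde C(zI-\tilde A)^{-1}\tilde B$ and $\hat G(z)=\hat D+\hat C(zI-\hat A)^{-1}\hat B$ satisfy $$\|\hat G-\tilde G\|_\infty^2\le\tilde\sigma_{k+1}^2+M\Big(\rho^{-1}\sup_{\mathrm{Re}(z)=0}\|X(z)^{-1}\|\,(\epsilon+Q_E+Q_U)+\sup_{\mathrm{Re}(z)=0}\|X(z)^{-1}\|^{2}\,Q_U+\rho^{-2}\epsilon\Big),$$ where $M=R\big(\|\tilde A\|,\|\tilde B\|,\|\tilde C\|,\tilde\sigma_1,1+Q_E,1+Q_U\big)$ and $$X(z)=-z(\tilde\Sigma_1^2-\tilde\sigma_{k+1}^2I_{K-r})-\tilde\sigma_{k+1}^2\tilde A_{11}-\tilde\Sigma_1\tilde A_{11}^*\tilde\Sigma_1+\tilde\sigma_{k+1}\tilde B_1U^*\tilde C_1 .$$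
   Context: Norms: $\|\cdot\|$ is the matrix spectral norm; for a matrix-valued function $f$ on the imaginary axis, $\|f\|_\infty=\mathrm{ess\,sup}_{\mathrm{Re}(z)=0}\|f(z)\|$. Pseudospectrum: for a square matrix $X$, $\sigma_\rho(X)=\{z\in\mathbb{C}: \|(zI-X)^{-1}\|>\rho^{-1}\}$, with the convention that the spectrum of $X$ is contained in $\sigma_\rho(X)$. Intermediate system: $\tilde A\in\mathbb{C}^{K\times K}$, $\tilde B\in\mathbb{C}^{K\times m}$, $\tilde C\in\mathbb{C}^{p\times K}$, $\tilde D\in\mathbb{C}^{p\times m}$, with $p\le m$ and the spectrum of $\tilde A$ in the open left half-plane. Let $\tilde\sigma_1\ge\cdots\ge\tilde\sigma_K\ge0$ be its Hankel singular values, $k$ the target rank, $\epsilon\ge0$ a tolerance, and $\hat\sigma=\tilde\sigma_{k+1}$. Let $j_1\le k+1\le j_2$ be such that $\tilde\sigma_{j_1},\dots,\tilde\sigma_{j_2}$ are exactly the Hankel singular values with $|\tilde\sigma_j-\tilde\sigma_{k+1}|\le\epsilon$, and let $r=j_2-j_1+1$. The system is balanced: with $\tilde\Sigma_1=\mathrm{diag}(\tilde\sigma_1,\dots,\tilde\sigma_{j_1-1},\tilde\sigma_{j_2+1},\dots,\tilde\sigma_K)$, $\tilde\Sigma_2=\mathrm{diag}(\tilde\sigma_{j_1},\dots,\tilde\sigma_{j_2})$ and $\tilde P=\tilde Q=\mathrm{diag}(\tilde\Sigma_1,\tilde\Sigma_2)$ one has the Lyapunov equations $\tilde A\tilde P+\tilde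 P\tilde A^*+\tilde B\tilde B^*=0$ and $\tilde A^*\tilde Q+\tilde Q\tilde A+\tilde C^*\tilde C=0$. Partition conformally $$\tilde A=\begin{bmatrix}\tilde A_{11}&\tilde A_{12}\\ \tilde A_{21}&\tilde A_{22}\end{bmatrix},\quad \tilde B=\begin{bmatrix}\tilde B_1\\ \tilde B_2\end{bmatrix},\quad \tilde C=\begin{bmatrix}\tilde C_1&\tilde C_2\end{bmatrix},$$ with $\tilde A_{11}\in\mathbb{C}^{(K-r)\times(K-r)}$, $\tilde B_1\in\mathbb{C}^{(K-r)\times m}$, $\tilde C_1\in\mathbb{C}^{p\times(K-r)}$. Construction of $U$: fix a threshold $\gamma\ge0$. Let $\tilde C_2^*=U_CS_CV_C^*$ be an SVD ($U_C\in\mathbb{C}^{r\times r}$, $S_C\in\mathbb{C}^{r\times p}$, $V_C\in\mathbb{C}^{p\times p}$), with singular values in decreasing order. Write $U_C=[\,U_C^{(1)}\mid U_C^{(2)}\,]$ and $S_C=\begin{bmatrix}S_C^{(1)}&0\\0&S_C^{(2)}\end{bmatrix}$ with $U_C^{(1)}\in\mathbb{C}^{r\times q}$, $S_C^{(1)}\in\mathbb{R}^{q\times q}$ invertible, where $1\le q\le \min(r,p)$ is the smallest number with $\|S_C^{(2)}\|\le\gamma$ (an empty block has norm $0$). Let $V_B^{(1)}\in\mathbb{C}^{m\times q}$ be given by $(V_B^{(1)})^*=-(S_C^{(1)})^{-1}(U_C^{(1)})^*\tilde B_2$, the least-squares solution of $(U_C^{(1)}S_C^{(1)})Y=-\tilde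 B_2$. Let $V_B=[\,V_B^{(1)}\mid V_B^{(2)}\,]\in\mathbb{C}^{m\times p}$, where the $p-q$ columns of $V_B^{(2)}$ are arbitrary orthonormal vectors orthogonal to the column space of $V_B^{(1)}$. Set $U=V_CV_B^*\in\mathbb{C}^{p\times m}$. Define $\Delta_1=\tilde B_2+\tilde C_2^*U$, $\Delta_2=I-UU^*$, $Q_E=\|\Delta_1\|$, $Q_U=\|\Delta_2\|$. Reduced system (modified HNA algorithm): $$\hat A=(\tilde\Sigma_1^2-\hat\sigma^2I)^{-1}(\hat\sigma^2\tilde A_{11}^*+\tilde\Sigma_1\tilde A_{11}\tilde\Sigma_1-\hat\sigma\tilde C_1^*U\tilde B_1^* ),\quad \hat B=(\tilde\Sigma_1^2-\hat\sigma^2I)^{-1}(\tilde\Sigma_1\tilde B_1+\hat\sigma\tilde C_1^*U),$$ $$\hat C=\tilde C_1\tilde\Sigma_1+\hat\sigma U\tilde B_1^*,\quad \hat D=\tilde D-\hat\sigma U .$$ If $X(z)$ is singular for some $z$ on the imaginary axis, the suprema are taken to be $+\infty$ (the bound is only informative when they are finite).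
   Formalization: "Degree 4" is read as: each single variable of R occurs with exponent at most 4 (with total degree 4 the claim is false); and r < K is assumed, so that X(z) is a non-empty matrix (for r = K the claim can fail). *)

theory Defs
  imports
    "HOL-Probability.Essential_Supremum"
    "HOL-Library.Poly_Mapping"
    "Jordan_Normal_Form.Schur_Decomposition"
    "Jordan_Normal_Form.Spectral_Radius"
    "Jordan_Normal_Form.Gauss_Jordan_Elimination"
begin

text \<open>Matrices are those of Jordan_Normal_Form, because the dimensions are quantified after the
  polynomial. Vectors and matrices are indexed from 0, whereas a list of singular values is a function
  \<^term>\<open>\<sigma> :: nat \<Rightarrow> real\<close> indexed from 1 as in the mathematical text.\<close>

section \<open>Multivariate polynomials\<close>

text \<open>A real polynomial maps exponent vectors to coefficients.\<close>

type_synonym real_mpoly = "(nat \<Rightarrow>\<^sub>0 nat) \<Rightarrow>\<^sub>0 real"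

definition mpoly_vars :: "real_mpoly \<Rightarrow> nat set" where
  "mpoly_vars R = (\<Union>\<mu>\<in>Poly_Mapping.keys R. Poly_Mapping.keys \<mu>)"

definition mpoly_eval :: "real_mpoly \<Rightarrow> (nat \<Rightarrow> real) \<Rightarrow> real" where
  "mpoly_eval R x = (\<Sum>\<mu>\<in>Poly_Mapping.keys R. Poly_Mapping.lookup R \<mu> * (\<Prod>i\<in>Poly_Mapping.keys \<mu>. x i ^ Poly_Mapping.lookup \<mu> i))"

text \<open>The degree is the largest exponent with which a single variable occurs, not the total degree.
  With the total degree, the error bound of the modified HNA algorithm fails for every polynomial of degree 4.
  Take three decoupled scalar channels c^2/(z + a) with input and output coefficient c, c^2 = 2 a \<sigma>,
  (a, \<sigma>) = (1, 2), (2, 1), (1, 1), and k = 1, \<epsilon> = 0, \<gamma> = 2. Then q = 1, and U = diag(1, -1, 1) is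
  admissible, so that Q_U = 0 and Q_E > 0, while the error in the third channel at z = 0 has absolute
  value 3. Multiplying A, B, C, Sigma, \<gamma>, \<rho> by t multiplies the squared error by t^2, but
  the error term on the right by M/t^3, and M grows only like t^4.\<close>

definition mpoly_degree :: "real_mpoly \<Rightarrow> nat" where
  "mpoly_degree R = Max (insert 0 (\<Union>\<mu>\<in>Poly_Mapping.keys R. Poly_Mapping.lookup \<mu> ` Poly_Mapping.keys \<mu>))"

definition mpoly_positive_coeffs :: "real_mpoly \<Rightarrow> bool" where
  "mpoly_positive_coeffs R \<longleftrightarrow> (\<forall>\<mu>\<in>Poly_Mapping.keys R. Poly_Mapping.lookup R \<mu> > 0)"

section \<open>Matrices\<close>

definition vec_norm2 :: "complex vec \<Rightarrow> real" where
  "vec_norm2 v = L2_set (\<lambda>i. cmod (v $ i)) {..<dim_vec v}"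

definition spectral_norm :: "complex mat \<Rightarrow> real" where
  "spectral_norm A =
     Sup {vec_norm2 (A *\<^sub>v v) | v. v \<in> carrier_vec (dim_col A) \<and> vec_norm2 v \<le> 1}"

text \<open>Unspecified if the matrix is singular.\<close>

definition inv_mat :: "complex mat \<Rightarrow> complex mat" where
  "inv_mat A = the (mat_inverse A)"

text \<open>With this convention a supremum of \<^term>\<open>inv_norm (X z)\<close> is infinite as soon as one
  \<^term>\<open>X z\<close> is singular. Since 0 times infinity is 0 in \<^typ>\<open>ereal\<close>, a bound that is meant to be
  void in this case has to assume finiteness of the supremum.\<close>

definition inv_norm :: "complex mat \<Rightarrow> ereal" where
  "inv_norm A = (if invertible_mat A then ereal (spectral_norm (inv_mat A)) else \<infinity>)"

definition unitary_mat :: "nat \<Rightarrow> complex mat \<Rightarrow> bool" where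
  "unitary_mat n W \<longleftrightarrow> W \<in> carrier_mat n n \<and> mat_adjoint W * W = 1\<^sub>m n"

definition real_diag :: "real list \<Rightarrow> complex mat" where
  "real_diag xs = mat_diag (length xs) (\<lambda>i. complex_of_real (xs ! i))"

definition upper_left :: "'a mat \<Rightarrow> nat \<Rightarrow> nat \<Rightarrow> 'a mat" where
  "upper_left A nr nc = mat nr nc (\<lambda>(i, j). A $$ (i, j))"

definition lower_right :: "'a mat \<Rightarrow> nat \<Rightarrow> nat \<Rightarrow> 'a mat" where
  "lower_right A i0 j0 =
     mat (dim_row A - i0) (dim_col A - j0) (\<lambda>(i, j). A $$ (i0 + i, j0 + j))"

text \<open>As \<^const>\<open>inv_norm\<close> is infinite on singular matrices, the spectrum is included.\<close>

definition pseudospectrum :: "real \<Rightarrow> complex mat \<Rightarrow> complex set" where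
  "pseudospectrum \<rho> A = {z. inv_norm (z \<cdot>\<^sub>m 1\<^sub>m (dim_row A) - A) > ereal (1 / \<rho>)}"

section \<open>Linear systems\<close>

abbreviation imag_axis :: "complex set" where
  "imag_axis \<equiv> {z. Re z = 0}"

definition transfer ::
  "complex mat \<Rightarrow> complex mat \<Rightarrow> complex mat \<Rightarrow> complex mat \<Rightarrow> complex \<Rightarrow> complex mat" where
  "transfer A B C D z = D + C * inv_mat (z \<cdot>\<^sub>m 1\<^sub>m (dim_row A) - A) * B"

definition axis_norm :: "(complex \<Rightarrow> complex mat) \<Rightarrow> ereal" where
  "axis_norm f = esssup lborel (\<lambda>y. ereal (spectral_norm (f (Complex 0 y))))"

definition stable_mat :: "complex mat \<Rightarrow> bool" where
  "stable_mat A \<longleftrightarrow> (\<forall>z\<in>spectrum A. Re z < 0)"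

definition controllability_lyapunov :: "complex mat \<Rightarrow> complex mat \<Rightarrow> complex mat \<Rightarrow> bool" where
  "controllability_lyapunov A B P \<longleftrightarrow>
     A * P + P * mat_adjoint A + B * mat_adjoint B = 0\<^sub>m (dim_row A) (dim_row A)"

definition observability_lyapunov :: "complex mat \<Rightarrow> complex mat \<Rightarrow> complex mat \<Rightarrow> bool" where
  "observability_lyapunov A C Q \<longleftrightarrow>
     mat_adjoint A * Q + Q * A + mat_adjoint C * C = 0\<^sub>m (dim_row A) (dim_row A)"

text \<open>The Hankel singular values of a stable system are the square roots of the eigenvalues of
  \<^term>\<open>P * Q\<close>, counted with algebraic multiplicity, where P and Q are the Gramians; these are the
  unique solutions of the Lyapunov equations.\<close>

definition hankel_singular_values ::
  "nat \<Rightarrow> complex mat \<Rightarrow> complex mat \<Rightarrow> complex mat \<Rightarrow> (nat \<Rightarrow> real) \<Rightarrow> bool" where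
  "hankel_singular_values K A B C \<sigma> \<longleftrightarrow>
     (\<forall>i\<in>{1..K}. 0 \<le> \<sigma> i) \<and> (\<forall>i\<in>{1..K}. \<forall>j\<in>{1..K}. i \<le> j \<longrightarrow> \<sigma> j \<le> \<sigma> i) \<and>
     (\<exists>P\<in>carrier_mat K K. \<exists>Q\<in>carrier_mat K K.
        controllability_lyapunov A B P \<and> observability_lyapunov A C Q \<and>
        char_poly (P * Q) = (\<Prod>i\<in>{1..K}. [:- complex_of_real ((\<sigma> i)\<^sup>2), 1:]))"

definition Sigma1 :: "nat \<Rightarrow> nat \<Rightarrow> nat \<Rightarrow> (nat \<Rightarrow> real) \<Rightarrow> complex mat" where
  "Sigma1 K j1 j2 \<sigma> = real_diag (map \<sigma> ([1..<j1] @ [j2 + 1..<K + 1]))"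

definition Sigma2 :: "nat \<Rightarrow> nat \<Rightarrow> (nat \<Rightarrow> real) \<Rightarrow> complex mat" where
  "Sigma2 j1 j2 \<sigma> = real_diag (map \<sigma> [j1..<j2 + 1])"

definition stable_balanced_system ::
  "nat \<Rightarrow> nat \<Rightarrow> nat \<Rightarrow> complex mat \<Rightarrow> complex mat \<Rightarrow> complex mat \<Rightarrow> complex mat \<Rightarrow>
   (nat \<Rightarrow> real) \<Rightarrow> nat \<Rightarrow> real \<Rightarrow> nat \<Rightarrow> nat \<Rightarrow> bool" where
  "stable_balanced_system K m p A B C D \<sigma> k \<epsilon> j1 j2 \<longleftrightarrow>
     A \<in> carrier_mat K K \<and> B \<in> carrier_mat K m \<and> C \<in> carrier_mat p K \<and> D \<in> carrier_mat p m \<and>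
     p \<le> m \<and> stable_mat A \<and> hankel_singular_values K A B C \<sigma> \<and>
     0 \<le> \<epsilon> \<and> 1 \<le> j1 \<and> j1 \<le> k + 1 \<and> k + 1 \<le> j2 \<and> j2 \<le> K \<and>
     {j \<in> {1..K}. \<bar>\<sigma> j - \<sigma> (k + 1)\<bar> \<le> \<epsilon>} = {j1..j2} \<and>
     (let r = j2 - j1 + 1;
          P = four_block_mat (Sigma1 K j1 j2 \<sigma>) (0\<^sub>m (K - r) r) (0\<^sub>m r (K - r)) (Sigma2 j1 j2 \<sigma>)
      in controllability_lyapunov A B P \<and> observability_lyapunov A C P)"

section \<open>The modified HNA algorithm\<close>

definition is_svd ::
  "nat \<Rightarrow> nat \<Rightarrow> complex mat \<Rightarrow> complex mat \<Rightarrow> complex mat \<Rightarrow> complex mat \<Rightarrow> bool" where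
  "is_svd nr nc M W S V \<longleftrightarrow>
     unitary_mat nr W \<and> unitary_mat nc V \<and> M = W * S * mat_adjoint V \<and>
     (\<exists>s :: nat \<Rightarrow> real.
        S = mat nr nc (\<lambda>(i, j). if i = j then complex_of_real (s i) else 0) \<and>
        (\<forall>i < min nr nc. 0 \<le> s i) \<and> (\<forall>i j. i \<le> j \<longrightarrow> j < min nr nc \<longrightarrow> s j \<le> s i))"

definition truncation_index :: "real \<Rightarrow> nat \<Rightarrow> nat \<Rightarrow> complex mat \<Rightarrow> nat \<Rightarrow> bool" where
  "truncation_index \<gamma> r p S q \<longleftrightarrow>
     1 \<le> q \<and> q \<le> min r p \<and> spectral_norm (lower_right S q q) \<le> \<gamma> \<and>
     (\<forall>q'. 1 \<le> q' \<and> q' \<le> min r p \<and> spectral_norm (lower_right S q' q') \<le> \<gamma> \<longrightarrow> q \<le> q')"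

text \<open>\<^term>\<open>U\<close> is one of the possible outcomes of the construction, which leaves the SVD and the
  trailing columns of \<^term>\<open>VB\<close> free. Here \<^term>\<open>V1\<close> and \<^term>\<open>V2\<close> are the leading \<^term>\<open>q\<close> and the
  trailing \<^term>\<open>p - q\<close> columns of \<^term>\<open>VB\<close>.\<close>

definition hna_U ::
  "real \<Rightarrow> nat \<Rightarrow> nat \<Rightarrow> nat \<Rightarrow> complex mat \<Rightarrow> complex mat \<Rightarrow> complex mat \<Rightarrow> bool" where
  "hna_U \<gamma> r m p B2 C2 U \<longleftrightarrow>
     (\<exists>UC SC VC q VB.
        is_svd r p (mat_adjoint C2) UC SC VC \<and> truncation_index \<gamma> r p SC q \<and>
        invertible_mat (upper_left SC q q) \<and> VB \<in> carrier_mat m p \<and>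
        (let UC1 = upper_left UC r q; S1 = upper_left SC q q;
             V1 = upper_left VB m q; V2 = lower_right VB 0 q
         in mat_adjoint V1 = - (inv_mat S1 * mat_adjoint UC1 * B2) \<and>
            mat_adjoint V2 * V2 = 1\<^sub>m (p - q) \<and>
            mat_adjoint V1 * V2 = 0\<^sub>m q (p - q)) \<and>
        U = VC * mat_adjoint VB)"

definition hna_Gamma :: "complex mat \<Rightarrow> real \<Rightarrow> complex mat" where
  "hna_Gamma S s = S * S - complex_of_real (s\<^sup>2) \<cdot>\<^sub>m 1\<^sub>m (dim_row S)"

text \<open>In the following \<^term>\<open>S\<close> stands for the matrix Sigma1 and \<^term>\<open>s\<close> for the singular value with
  index \<^term>\<open>k + 1\<close>.\<close>

definition hna_A ::
  "complex mat \<Rightarrow> real \<Rightarrow> complex mat \<Rightarrow> complex mat \<Rightarrow> complex mat \<Rightarrow> complex mat \<Rightarrow> complex mat" where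
  "hna_A S s A11 B1 C1 U =
     inv_mat (hna_Gamma S s) *
       (complex_of_real (s\<^sup>2) \<cdot>\<^sub>m mat_adjoint A11 + S * A11 * S
        - complex_of_real s \<cdot>\<^sub>m (mat_adjoint C1 * U * mat_adjoint B1))"

definition hna_B ::
  "complex mat \<Rightarrow> real \<Rightarrow> complex mat \<Rightarrow> complex mat \<Rightarrow> complex mat \<Rightarrow> complex mat" where
  "hna_B S s B1 C1 U =
     inv_mat (hna_Gamma S s) * (S * B1 + complex_of_real s \<cdot>\<^sub>m (mat_adjoint C1 * U))"

definition hna_C ::
  "complex mat \<Rightarrow> real \<Rightarrow> complex mat \<Rightarrow> complex mat \<Rightarrow> complex mat \<Rightarrow> complex mat" where
  "hna_C S s B1 C1 U = C1 * S + complex_of_real s \<cdot>\<^sub>m (U * mat_adjoint B1)"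

definition hna_D :: "real \<Rightarrow> complex mat \<Rightarrow> complex mat \<Rightarrow> complex mat" where
  "hna_D s D U = D - complex_of_real s \<cdot>\<^sub>m U"

text \<open>The error bound needs Sigma1 to be non-empty: for r = K the matrix X(z) is empty, its inverse
  has norm 0, and the term with Q_E disappears although Q_E may be positive.\<close>

definition hna_X ::
  "complex mat \<Rightarrow> real \<Rightarrow> complex mat \<Rightarrow> complex mat \<Rightarrow> complex mat \<Rightarrow> complex mat \<Rightarrow>
   complex \<Rightarrow> complex mat" where
  "hna_X S s A11 B1 C1 U z =
     (- z) \<cdot>\<^sub>m hna_Gamma S s - complex_of_real (s\<^sup>2) \<cdot>\<^sub>m A11 - S * mat_adjoint A11 * S
     + complex_of_real s \<cdot>\<^sub>m (B1 * mat_adjoint U * C1)"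

end

theory Submission
  imports Defs
begin

text \<open>Write \<open>s\<close> for the singular value with index \<open>k + 1\<close>, \<open>S\<close> for Sigma1, \<open>T\<close> for Sigma2 and \<open>\<Gamma>\<close> for
  \<open>S\<^sup>2 - s\<^sup>2 I\<close>. If all singular values in \<open>T\<close> equal \<open>s\<close>, if \<open>B2 = - C2\<^sup>* U\<close> and if \<open>U U\<^sup>* = I\<close>, then the
  error \<open>E = G - Gh\<close> is \<open>s\<close> times an all-pass function: \<open>E E\<^sup>* = s\<^sup>2 I\<close> on the imaginary axis. This is
  Glover's argument. The error system has a controllability Gramian, and for purely imaginary \<open>z\<close> a
  Lyapunov equation says that \<open>B B\<^sup>* = R P + P R\<^sup>*\<close> with \<open>R = z I - A\<close>; so each term of
  \<open>C R\<^sup>-\<^sup>1 B B\<^sup>* R\<^sup>-\<^sup>* C\<^sup>*\<close> loses one resolvent, and what remains cancels against the cross terms with the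
  constant term \<open>s U\<close> of the error.

  Without these ideal conditions the same computation leaves residual terms, and each of them contains
  one of \<open>T - s I\<close>, \<open>B2 + C2\<^sup>* U\<close>, \<open>I - U U\<^sup>*\<close>, whose norms are at most \<open>\<epsilon>\<close>, \<open>QE\<close> and \<open>QU\<close>
  (\<open>error_identity\<close>). The resolvent of the reduced system enters through \<open>X(z)\<close>, since on the axis the
  adjoint of \<open>X(z)\<close> is \<open>\<Gamma>\<close> times the matrix to be inverted (\<open>reduced_resolvent\<close>).

  The squared norm of \<open>E\<close> is at most the norm of \<open>E E\<^sup>*\<close>, so it suffices to bound the residual terms. They
  do not all have the factors \<open>1/\<rho>\<close> and \<open>x = sup |X(z)\<^sup>-\<^sup>1|\<close> of the asserted bound. But
  \<open>1 \<le> |A| / \<rho>\<close> and \<open>1 \<le> x |X(0)|\<close>, because a matrix and its inverse cannot both be small, and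
  these inequalities supply the missing factors at the price of further powers of the norms
  (\<open>error_budget\<close>). In the end each of the norms, \<open>\<sigma> 1\<close> and \<open>1 + QU\<close> occurs at most to the fourth
  power, so a large multiple of the product of all \<open>x\<^sub>i\<^sup>4 + 1\<close> can serve as the polynomial.

  The norm on the axis is an essential supremum, which requires the error to be measurable; it is
  Lipschitz continuous by the resolvent identity (\<open>axis_norm_error_bound\<close>).\<close>

section \<open>Matrix algebra by rewriting\<close>

text \<open>The ring laws for matrices are stated with dimension equations such as
  \<^term>\<open>dim_col A = dim_row B\<close> as premises. The simplifier can compute both sides of such an equation
  for compound matrices, whereas the middle dimension of a product cannot be read off its carrier.
  Used from left to right, the laws multiply out an expression and bracket products to the right.
  After that an identity between matrices is linear in the products, and comparing entries proves it if
  the entries of products stay atomic; this is why so many proofs below end with \<open>eq_matI\<close> and remove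
  \<open>index_mult_mat(1)\<close> from the simpset.\<close>

named_theorems mat_laws

lemma assoc_mult_mat_dims [mat_laws]:
  "dim_col A = dim_row B \<Longrightarrow> dim_col B = dim_row C \<Longrightarrow> A * B * C = A * (B * C :: 'a :: semiring_0 mat)"
  by (rule assoc_mult_mat) auto

lemma mult_add_distrib_mat_dims [mat_laws]:
  "dim_row B = dim_row C \<Longrightarrow> dim_col B = dim_col C \<Longrightarrow> dim_col A = dim_row B \<Longrightarrow>
   A * (B + C) = A * B + (A * C :: 'a :: semiring_0 mat)"
  by (rule mult_add_distrib_mat) auto

lemma add_mult_distrib_mat_dims [mat_laws]:
  "dim_row A = dim_row B \<Longrightarrow> dim_col A = dim_col B \<Longrightarrow> dim_col B = dim_row C \<Longrightarrow>
   (A + B) * C = A * C + (B * C :: 'a :: semiring_0 mat)"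
  by (rule add_mult_distrib_mat) auto

lemma mult_minus_distrib_mat_dims [mat_laws]:
  "dim_row B = dim_row C \<Longrightarrow> dim_col B = dim_col C \<Longrightarrow> dim_col A = dim_row B \<Longrightarrow>
   A * (B - C) = A * B - (A * C :: 'a :: ring mat)"
  by (rule mult_minus_distrib_mat) auto

lemma minus_mult_distrib_mat_dims [mat_laws]:
  "dim_row A = dim_row B \<Longrightarrow> dim_col A = dim_col B \<Longrightarrow> dim_col B = dim_row C \<Longrightarrow>
   (A - B) * C = A * C - (B * C :: 'a :: ring mat)"
  by (rule minus_mult_distrib_mat) auto

lemma smult_mult_mat_dims [mat_laws]:
  "dim_col A = dim_row B \<Longrightarrow> (c \<cdot>\<^sub>m A) * B = c \<cdot>\<^sub>m (A * B :: 'a :: comm_semiring_0 mat)"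
  by (rule mult_smult_assoc_mat) auto

lemma mult_smult_mat_dims [mat_laws]:
  "dim_col A = dim_row B \<Longrightarrow> A * (c \<cdot>\<^sub>m B) = c \<cdot>\<^sub>m (A * B :: 'a :: comm_semiring_0 mat)"
  by (rule mult_smult_distrib) auto

lemma smult_add_mat_dims [mat_laws]:
  "dim_row A = dim_row B \<Longrightarrow> dim_col A = dim_col B \<Longrightarrow>
   c \<cdot>\<^sub>m (A + B) = c \<cdot>\<^sub>m A + c \<cdot>\<^sub>m (B :: 'a :: semiring_0 mat)"
  by (rule eq_matI) (auto simp: algebra_simps)

lemma smult_minus_mat_dims [mat_laws]:
  "dim_row A = dim_row B \<Longrightarrow> dim_col A = dim_col B \<Longrightarrow>
   c \<cdot>\<^sub>m (A - B) = c \<cdot>\<^sub>m A - c \<cdot>\<^sub>m (B :: 'a :: ring mat)"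
  by (rule eq_matI) (auto simp: algebra_simps)

lemma smult_smult_mat [mat_laws]: "c \<cdot>\<^sub>m (d \<cdot>\<^sub>m A) = (c * d) \<cdot>\<^sub>m (A :: 'a :: semiring_0 mat)"
  by (rule eq_matI) (auto simp: algebra_simps)

lemma one_mult_mat_dims [mat_laws]: "dim_row A = n \<Longrightarrow> 1\<^sub>m n * A = (A :: 'a :: semiring_1 mat)"
  by (rule left_mult_one_mat) auto

lemma mult_one_mat_dims [mat_laws]: "dim_col A = n \<Longrightarrow> A * 1\<^sub>m n = (A :: 'a :: semiring_1 mat)"
  by (rule right_mult_one_mat) auto

lemma mult_zero_mat_dims [mat_laws]:
  "dim_col A = n \<Longrightarrow> A * 0\<^sub>m n k = 0\<^sub>m (dim_row (A :: 'a :: semiring_0 mat)) k"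
  by (rule right_mult_zero_mat) auto

lemma zero_add_mat_dims [mat_laws]:
  "dim_row A = k \<Longrightarrow> dim_col A = l \<Longrightarrow> 0\<^sub>m k l + A = (A :: 'a :: monoid_add mat)"
  "dim_row A = k \<Longrightarrow> dim_col A = l \<Longrightarrow> A + 0\<^sub>m k l = A"
  by (auto intro!: eq_matI)

text \<open>Cancellation inside a product that is bracketed to the right.\<close>

lemma mult_cancel_dims:
  fixes G :: "complex mat"
  assumes "G * H = 1\<^sub>m n" "dim_col G = dim_row H" "dim_col H = dim_row Y" "dim_row Y = n"
  shows "G * (H * Y) = Y"
  using assms by (simp flip: assoc_mult_mat_dims add: one_mult_mat_dims)

lemma assoc_mult_mat_vec_dims:
  assumes "dim_col A = dim_row B" "v \<in> carrier_vec (dim_col B)"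
  shows "(A * B) *\<^sub>v v = A *\<^sub>v (B *\<^sub>v (v :: 'a :: semiring_0 vec))"
  by (rule assoc_mult_mat_vec[OF carrier_matI[OF refl assms(1)] carrier_matI[OF refl refl] assms(2)])

lemma mat_adjoint_dims [simp]:
  "dim_row (mat_adjoint A) = dim_col A" "dim_col (mat_adjoint A) = dim_row A"
  by (simp_all add: mat_adjoint_def)

lemma mat_adjoint_index [simp]:
  fixes A :: "complex mat"
  assumes "i < dim_col A" "j < dim_row A"
  shows "mat_adjoint A $$ (i, j) = cnj (A $$ (j, i))"
  using assms by (simp add: mat_adjoint_def mat_of_rows_index)

lemma mat_adjoint_carrier [simp]:
  "A \<in> carrier_mat r c \<Longrightarrow> mat_adjoint A \<in> carrier_mat c r"
  by (intro carrier_matI) auto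

lemma mat_adjoint_adjoint [simp]: "mat_adjoint (mat_adjoint A) = (A :: complex mat)"
  by (rule eq_matI) auto

lemma mat_adjoint_add:
  fixes A :: "complex mat"
  shows "dim_row A = dim_row B \<Longrightarrow> dim_col A = dim_col B \<Longrightarrow>
    mat_adjoint (A + B) = mat_adjoint A + mat_adjoint B"
  by (rule eq_matI) auto

lemma mat_adjoint_minus:
  fixes A :: "complex mat"
  shows "dim_row A = dim_row B \<Longrightarrow> dim_col A = dim_col B \<Longrightarrow>
    mat_adjoint (A - B) = mat_adjoint A - mat_adjoint B"
  by (rule eq_matI) auto

lemma mat_adjoint_smult: "mat_adjoint (c \<cdot>\<^sub>m A) = cnj c \<cdot>\<^sub>m mat_adjoint (A :: complex mat)"
  by (rule eq_matI) auto

lemma mat_adjoint_one [simp]: "mat_adjoint (1\<^sub>m n) = (1\<^sub>m n :: complex mat)"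
  by (rule eq_matI) auto

lemma mat_adjoint_zero [simp]: "mat_adjoint (0\<^sub>m a b) = (0\<^sub>m b a :: complex mat)"
  by (rule eq_matI) auto

lemma mat_adjoint_mult:
  fixes A :: "complex mat"
  assumes "dim_col A = dim_row B"
  shows "mat_adjoint (A * B) = mat_adjoint B * mat_adjoint A"
  by (rule eq_matI) (use assms in \<open>auto simp: scalar_prod_def intro!: sum.cong\<close>)

lemmas adjoint_laws = mat_adjoint_add mat_adjoint_minus mat_adjoint_smult mat_adjoint_mult

section \<open>The spectral norm\<close>

lemma vec_norm2_nonneg [simp]: "0 \<le> vec_norm2 v"
  by (simp add: vec_norm2_def)

lemma vec_norm2_sq: "(vec_norm2 v)\<^sup>2 = (\<Sum>i<dim_vec v. (cmod (v $ i))\<^sup>2)"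
  by (simp add: vec_norm2_def L2_set_def sum_nonneg)

lemma vec_norm2_zero [simp]: "vec_norm2 (0\<^sub>v n) = 0"
  by (simp add: vec_norm2_def L2_set_def)

lemma vec_norm2_eq_0: "vec_norm2 v = 0 \<Longrightarrow> v = 0\<^sub>v (dim_vec v)"
  by (auto simp: vec_norm2_def L2_set_eq_0_iff intro!: eq_vecI)

lemma vec_norm2_smult [simp]: "vec_norm2 (c \<cdot>\<^sub>v v) = cmod c * vec_norm2 v"
  by (auto simp: vec_norm2_def norm_mult L2_set_right_distrib intro!: L2_set_cong)

lemma vec_norm2_add:
  assumes "dim_vec v = dim_vec w"
  shows "vec_norm2 (v + w) \<le> vec_norm2 v + vec_norm2 w"
proof -
  have "vec_norm2 (v + w) \<le> L2_set (\<lambda>i. cmod (v $ i) + cmod (w $ i)) {..<dim_vec w}"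
    unfolding vec_norm2_def using assms by (auto intro!: L2_set_mono norm_triangle_ineq)
  also have "\<dots> \<le> vec_norm2 v + vec_norm2 w"
    unfolding vec_norm2_def using assms by (simp add: L2_set_triangle_ineq)
  finally show ?thesis .
qed

lemma vec_norm2_self_inner: "complex_of_real ((vec_norm2 v)\<^sup>2) = v \<bullet>c v"
  by (auto simp: vec_norm2_sq scalar_prod_def complex_norm_square lessThan_atLeast0
      simp del: of_real_power intro!: sum.cong)

lemma cmod_inner_le:
  assumes "dim_vec v = dim_vec w"
  shows "cmod (v \<bullet>c w) \<le> vec_norm2 v * vec_norm2 w"
proof -
  have "cmod (v \<bullet>c w) \<le> (\<Sum>i<dim_vec w. \<bar>cmod (v $ i)\<bar> * \<bar>cmod (w $ i)\<bar>)"
    unfolding scalar_prod_def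
    by (rule order_trans[OF norm_sum]) (auto simp: norm_mult lessThan_atLeast0)
  also have "\<dots> \<le> vec_norm2 v * vec_norm2 w"
    unfolding vec_norm2_def assms by (rule L2_set_mult_ineq)
  finally show ?thesis .
qed

lemma inner_mult_mat_adjoint:
  fixes A :: "complex mat"
  assumes v: "v \<in> carrier_vec (dim_col A)" and w: "w \<in> carrier_vec (dim_row A)"
  shows "(A *\<^sub>v v) \<bullet>c w = v \<bullet>c (mat_adjoint A *\<^sub>v w)"
proof -
  have "(A *\<^sub>v v) \<bullet>c w = (\<Sum>i<dim_row A. \<Sum>j<dim_col A. A $$ (i, j) * v $ j * cnj (w $ i))"
    using v w by (auto simp: scalar_prod_def sum_distrib_right lessThan_atLeast0 intro!: sum.cong)
  also have "\<dots> = (\<Sum>j<dim_col A. \<Sum>i<dim_row A. A $$ (i, j) * v $ j * cnj (w $ i))"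
    by (rule sum.swap)
  also have "\<dots> = v \<bullet>c (mat_adjoint A *\<^sub>v w)"
    using v w by (auto simp: scalar_prod_def sum_distrib_left lessThan_atLeast0 mult_ac intro!: sum.cong)
  finally show ?thesis .
qed

text \<open>Only finiteness of the bound matters: it makes the supremum in the definition of the spectral
  norm meaningful. The constant obtained is the Frobenius norm.\<close>
lemma vec_norm2_mult_mat_vec_bounded:
  "\<exists>c. \<forall>v \<in> carrier_vec (dim_col A). vec_norm2 (A *\<^sub>v v) \<le> c * vec_norm2 v"
proof (intro exI ballI)
  fix v :: "complex vec" assume v: "v \<in> carrier_vec (dim_col A)"
  have "cmod ((A *\<^sub>v v) $ i) \<le> vec_norm2 (row A i) * vec_norm2 v" if "i < dim_row A" for i
  proof -
    have "(A *\<^sub>v v) $ i = row A i \<bullet>c (conjugate v)"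
      using that by simp
    also have "cmod \<dots> \<le> vec_norm2 (row A i) * vec_norm2 (conjugate v)"
      using v by (intro cmod_inner_le) auto
    also have "vec_norm2 (conjugate v) = vec_norm2 v"
      by (auto simp: vec_norm2_def intro!: L2_set_cong)
    finally show ?thesis .
  qed
  then have "vec_norm2 (A *\<^sub>v v) \<le> L2_set (\<lambda>i. vec_norm2 (row A i) * vec_norm2 v) {..<dim_row A}"
    unfolding vec_norm2_def by (auto intro!: L2_set_mono)
  also have "\<dots> = L2_set (\<lambda>i. vec_norm2 (row A i)) {..<dim_row A} * vec_norm2 v"
    by (simp add: L2_set_left_distrib)
  finally show "vec_norm2 (A *\<^sub>v v) \<le> L2_set (\<lambda>i. vec_norm2 (row A i)) {..<dim_row A} * vec_norm2 v" .
qed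

lemma spectral_norm_bdd:
  "bdd_above {vec_norm2 (A *\<^sub>v v) |v. v \<in> carrier_vec (dim_col A) \<and> vec_norm2 v \<le> 1}"
proof -
  obtain c where c: "\<And>v. v \<in> carrier_vec (dim_col A) \<Longrightarrow> vec_norm2 (A *\<^sub>v v) \<le> c * vec_norm2 v"
    using vec_norm2_mult_mat_vec_bounded[of A] by blast
  have "vec_norm2 (A *\<^sub>v v) \<le> \<bar>c\<bar>" if "v \<in> carrier_vec (dim_col A)" "vec_norm2 v \<le> 1" for v
  proof -
    have "vec_norm2 (A *\<^sub>v v) \<le> c * vec_norm2 v" by (rule c) fact
    also have "\<dots> \<le> \<bar>c\<bar> * vec_norm2 v" by (intro mult_right_mono) auto
    also have "\<dots> \<le> \<bar>c\<bar>" using that by (simp add: mult_left_le)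
    finally show ?thesis .
  qed
  then show ?thesis by (auto intro!: bdd_aboveI[of _ "\<bar>c\<bar>"])
qed

lemma spectral_norm_nonneg [simp]: "0 \<le> spectral_norm A"
  unfolding spectral_norm_def
  by (rule cSup_upper2[OF _ _ spectral_norm_bdd]) (auto intro!: exI[of _ "0\<^sub>v (dim_col A)"])

lemma vec_norm2_mult_mat_vec:
  assumes v: "v \<in> carrier_vec (dim_col A)"
  shows "vec_norm2 (A *\<^sub>v v) \<le> spectral_norm A * vec_norm2 v"
proof (cases "vec_norm2 v = 0")
  case True
  then have "v = 0\<^sub>v (dim_col A)" using vec_norm2_eq_0[OF True] v by auto
  then have "A *\<^sub>v v = 0\<^sub>v (dim_row A)" by auto
  then show ?thesis using True by simp
next
  case False
  let ?u = "complex_of_real (1 / vec_norm2 v) \<cdot>\<^sub>v v"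
  have "vec_norm2 (A *\<^sub>v ?u) \<le> spectral_norm A"
    unfolding spectral_norm_def using v False
    by (intro cSup_upper[OF _ spectral_norm_bdd]) (auto intro!: exI[of _ ?u] simp: norm_divide)
  also have "A *\<^sub>v ?u = complex_of_real (1 / vec_norm2 v) \<cdot>\<^sub>v (A *\<^sub>v v)"
    by (rule mult_mat_vec[OF carrier_matI[OF refl refl] v])
  finally show ?thesis
    using False by (simp add: norm_divide field_simps order_less_le)
qed

lemma spectral_norm_le:
  assumes "0 \<le> c" "\<And>v. v \<in> carrier_vec (dim_col A) \<Longrightarrow> vec_norm2 (A *\<^sub>v v) \<le> c * vec_norm2 v"
  shows "spectral_norm A \<le> c"
  unfolding spectral_norm_def
proof (rule cSup_least)
  show "{vec_norm2 (A *\<^sub>v v) |v. v \<in> carrier_vec (dim_col A) \<and> vec_norm2 v \<le> 1} \<noteq> {}"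
    by (auto intro!: exI[of _ "0\<^sub>v (dim_col A)"])
next
  fix x assume "x \<in> {vec_norm2 (A *\<^sub>v v) |v. v \<in> carrier_vec (dim_col A) \<and> vec_norm2 v \<le> 1}"
  then obtain v where "x = vec_norm2 (A *\<^sub>v v)" "v \<in> carrier_vec (dim_col A)" "vec_norm2 v \<le> 1"
    by auto
  then show "x \<le> c"
    using assms(2)[of v] mult_left_le[OF _ assms(1), of "vec_norm2 v"] by auto
qed

lemma spectral_norm_mult:
  assumes "dim_col A = dim_row B"
  shows "spectral_norm (A * B) \<le> spectral_norm A * spectral_norm B"
proof (rule spectral_norm_le)
  fix v :: "complex vec" assume "v \<in> carrier_vec (dim_col (A * B))"
  then have v: "v \<in> carrier_vec (dim_col B)" by simp
  have "(A * B) *\<^sub>v v = A *\<^sub>v (B *\<^sub>v v)"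
    by (rule assoc_mult_mat_vec_dims[OF assms v])
  also have "vec_norm2 \<dots> \<le> spectral_norm A * vec_norm2 (B *\<^sub>v v)"
    by (rule vec_norm2_mult_mat_vec) (use assms in \<open>auto intro: carrier_vecI\<close>)
  also have "\<dots> \<le> spectral_norm A * (spectral_norm B * vec_norm2 v)"
    by (intro mult_left_mono vec_norm2_mult_mat_vec v) simp
  finally show "vec_norm2 ((A * B) *\<^sub>v v) \<le> spectral_norm A * spectral_norm B * vec_norm2 v"
    by (simp add: mult_ac)
qed simp

lemma spectral_norm_add:
  assumes "dim_row A = dim_row B" "dim_col A = dim_col B"
  shows "spectral_norm (A + B) \<le> spectral_norm A + spectral_norm B"
proof (rule spectral_norm_le)
  fix v :: "complex vec" assume "v \<in> carrier_vec (dim_col (A + B))"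
  then have v: "v \<in> carrier_vec (dim_col B)" "v \<in> carrier_vec (dim_col A)" using assms by auto
  have "(A + B) *\<^sub>v v = A *\<^sub>v v + B *\<^sub>v v"
    by (rule add_mult_distrib_mat_vec[of A "dim_row A" "dim_col B"]) (use assms v in auto)
  also have "vec_norm2 \<dots> \<le> vec_norm2 (A *\<^sub>v v) + vec_norm2 (B *\<^sub>v v)"
    by (rule vec_norm2_add) (use assms in auto)
  also have "\<dots> \<le> spectral_norm A * vec_norm2 v + spectral_norm B * vec_norm2 v"
    by (intro add_mono vec_norm2_mult_mat_vec v)
  finally show "vec_norm2 ((A + B) *\<^sub>v v) \<le> (spectral_norm A + spectral_norm B) * vec_norm2 v"
    by (simp add: algebra_simps)
qed simp

lemma smult_mat_mult_vec:
  fixes A :: "'a :: comm_semiring_0 mat"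
  assumes "v \<in> carrier_vec (dim_col A)"
  shows "(c \<cdot>\<^sub>m A) *\<^sub>v v = c \<cdot>\<^sub>v (A *\<^sub>v v)"
  by (rule eq_vecI) (use assms in \<open>auto simp: scalar_prod_def sum_distrib_left mult_ac intro!: sum.cong\<close>)

lemma spectral_norm_smult_le: "spectral_norm (c \<cdot>\<^sub>m A) \<le> cmod c * spectral_norm A"
proof (rule spectral_norm_le)
  fix v :: "complex vec" assume "v \<in> carrier_vec (dim_col (c \<cdot>\<^sub>m A))"
  then show "vec_norm2 ((c \<cdot>\<^sub>m A) *\<^sub>v v) \<le> cmod c * spectral_norm A * vec_norm2 v"
    by (simp add: smult_mat_mult_vec mult.assoc mult_left_mono vec_norm2_mult_mat_vec)
qed simp

lemma spectral_norm_minus: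
  assumes "dim_row A = dim_row B" "dim_col A = dim_col B"
  shows "spectral_norm (A - B) \<le> spectral_norm A + spectral_norm B"
proof -
  have "A - B = A + (-1) \<cdot>\<^sub>m B" by (rule eq_matI) (use assms in auto)
  also have "spectral_norm \<dots> \<le> spectral_norm A + spectral_norm ((-1) \<cdot>\<^sub>m B)"
    using assms by (intro spectral_norm_add) auto
  finally show ?thesis using spectral_norm_smult_le[of "-1" B] by simp
qed

text \<open>The squared norm of \<open>A\<^sup>* w\<close> is the inner product of \<open>A A\<^sup>* w\<close> with \<open>w\<close>, to which Cauchy-Schwarz
  applies. The isometry of the adjoint and the C*-inequality both follow from this.\<close>
lemma vec_norm2_adjoint_sq:
  assumes w: "w \<in> carrier_vec (dim_row A)"
  shows "(vec_norm2 (mat_adjoint A *\<^sub>v w))\<^sup>2 \<le> vec_norm2 ((A * mat_adjoint A) *\<^sub>v w) * vec_norm2 w"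
proof -
  let ?u = "mat_adjoint A *\<^sub>v w"
  have u: "?u \<in> carrier_vec (dim_col A)" by (intro carrier_vecI) simp
  have "complex_of_real ((vec_norm2 ?u)\<^sup>2) = ?u \<bullet>c ?u"
    by (rule vec_norm2_self_inner)
  also have "\<dots> = (A *\<^sub>v ?u) \<bullet>c w"
    by (rule inner_mult_mat_adjoint[symmetric, OF u w])
  also have "A *\<^sub>v ?u = (A * mat_adjoint A) *\<^sub>v w"
    by (rule assoc_mult_mat_vec_dims[symmetric]) (use w in auto)
  finally have "cmod (complex_of_real ((vec_norm2 ?u)\<^sup>2)) = cmod (((A * mat_adjoint A) *\<^sub>v w) \<bullet>c w)"
    by simp
  also have "\<dots> \<le> vec_norm2 ((A * mat_adjoint A) *\<^sub>v w) * vec_norm2 w"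
    by (rule cmod_inner_le) (use w in auto)
  finally show ?thesis by (simp add: norm_power)
qed

lemma spectral_norm_adjoint [simp]: "spectral_norm (mat_adjoint A) = spectral_norm A"
proof -
  have le: "spectral_norm (mat_adjoint A) \<le> spectral_norm A" for A
  proof (rule spectral_norm_le)
    fix w :: "complex vec" assume "w \<in> carrier_vec (dim_col (mat_adjoint A))"
    then have w: "w \<in> carrier_vec (dim_row A)" by simp
    let ?u = "mat_adjoint A *\<^sub>v w"
    have "(vec_norm2 ?u)\<^sup>2 \<le> vec_norm2 ((A * mat_adjoint A) *\<^sub>v w) * vec_norm2 w"
      by (rule vec_norm2_adjoint_sq[OF w])
    also have "(A * mat_adjoint A) *\<^sub>v w = A *\<^sub>v ?u"
      by (rule assoc_mult_mat_vec_dims) (use w in auto)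
    also have "vec_norm2 (A *\<^sub>v ?u) * vec_norm2 w \<le> spectral_norm A * vec_norm2 ?u * vec_norm2 w"
      by (intro mult_right_mono vec_norm2_mult_mat_vec) (auto intro: carrier_vecI)
    finally have "vec_norm2 ?u * vec_norm2 ?u \<le> (spectral_norm A * vec_norm2 w) * vec_norm2 ?u"
      by (simp add: power2_eq_square mult_ac)
    then show "vec_norm2 ?u \<le> spectral_norm A * vec_norm2 w"
      by (cases "vec_norm2 ?u = 0") (auto simp: order_less_le)
  qed simp
  show ?thesis using le[of A] le[of "mat_adjoint A"] by simp
qed

text \<open>This inequality is what turns an identity for \<open>E E\<^sup>*\<close> into a bound on \<open>E\<close>.\<close>

lemma spectral_norm_sq_le: "(spectral_norm A)\<^sup>2 \<le> spectral_norm (A * mat_adjoint A)"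
proof -
  let ?N = "spectral_norm (A * mat_adjoint A)"
  have "spectral_norm (mat_adjoint A) \<le> sqrt ?N"
  proof (rule spectral_norm_le)
    fix w :: "complex vec" assume "w \<in> carrier_vec (dim_col (mat_adjoint A))"
    then have w: "w \<in> carrier_vec (dim_row A)" by simp
    have "(vec_norm2 (mat_adjoint A *\<^sub>v w))\<^sup>2 \<le> vec_norm2 ((A * mat_adjoint A) *\<^sub>v w) * vec_norm2 w"
      by (rule vec_norm2_adjoint_sq[OF w])
    also have "\<dots> \<le> ?N * vec_norm2 w * vec_norm2 w"
      by (intro mult_right_mono vec_norm2_mult_mat_vec) (use w in auto)
    also have "\<dots> = (sqrt ?N * vec_norm2 w)\<^sup>2"
      by (simp add: power_mult_distrib power2_eq_square)
    finally show "vec_norm2 (mat_adjoint A *\<^sub>v w) \<le> sqrt ?N * vec_norm2 w"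
      by (rule power2_le_imp_le) simp
  qed simp
  then have "(spectral_norm A)\<^sup>2 \<le> (sqrt ?N)\<^sup>2"
    by (intro power_mono) auto
  then show ?thesis by simp
qed

lemma spectral_norm_one_le: "spectral_norm (1\<^sub>m n) \<le> 1"
  by (rule spectral_norm_le) auto

lemma spectral_norm_one_ge:
  assumes "0 < n"
  shows "1 \<le> spectral_norm (1\<^sub>m n)"
proof -
  have "vec_norm2 (unit_vec n 0) = 1"
    using assms by (simp add: vec_norm2_def L2_set_def power2_eq_square if_distrib[of cmod]
        if_distrib[of "\<lambda>x. x * _"] sum.delta cong: if_cong)
  moreover have "vec_norm2 (1\<^sub>m n *\<^sub>v unit_vec n 0) \<le> spectral_norm (1\<^sub>m n) * vec_norm2 (unit_vec n 0)"
    by (rule vec_norm2_mult_mat_vec) auto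
  ultimately show ?thesis by simp
qed

lemma spectral_norm_mat_diag_le:
  assumes "0 \<le> c" "\<And>i. i < n \<Longrightarrow> cmod (f i) \<le> c"
  shows "spectral_norm (mat_diag n f) \<le> c"
proof (rule spectral_norm_le[OF assms(1)])
  fix v :: "complex vec" assume "v \<in> carrier_vec (dim_col (mat_diag n f))"
  then have v: "dim_vec v = n" by (simp add: mat_diag_def)
  have entry: "(mat_diag n f *\<^sub>v v) $ i = f i * v $ i" if "i < n" for i
    using that v by (simp add: mat_diag_def scalar_prod_def if_distrib[of "\<lambda>x. x * _"] sum.delta' cong: if_cong)
  have "vec_norm2 (mat_diag n f *\<^sub>v v) \<le> L2_set (\<lambda>i. c * cmod (v $ i)) {..<n}"
    unfolding vec_norm2_def
    by (simp add: mat_diag_def del: index_mult_mat_vec)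
      (auto simp: entry[unfolded mat_diag_def] norm_mult assms(2) mult_right_mono simp del: index_mult_mat_vec intro!: L2_set_mono)
  also have "\<dots> = c * vec_norm2 v"
    using v assms(1) by (simp add: vec_norm2_def L2_set_right_distrib)
  finally show "vec_norm2 (mat_diag n f *\<^sub>v v) \<le> c * vec_norm2 v" .
qed

text \<open>The next four rules compute a bound for an expression from bounds for its constituents.\<close>

lemma spectral_norm_mult_le:
  assumes "dim_col A = dim_row B" "spectral_norm A \<le> a" "spectral_norm B \<le> b"
  shows "spectral_norm (A * B) \<le> a * b"
  using spectral_norm_mult[OF assms(1)] mult_mono[OF assms(2,3)]
    order_trans[OF spectral_norm_nonneg assms(2)] by simp

lemma spectral_norm_add_le:
  assumes "dim_row A = dim_row B" "dim_col A = dim_col B" "spectral_norm A \<le> a" "spectral_norm B \<le> b"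
  shows "spectral_norm (A + B) \<le> a + b"
  using spectral_norm_add[OF assms(1,2)] assms(3,4) by simp

lemma spectral_norm_minus_le:
  assumes "dim_row A = dim_row B" "dim_col A = dim_col B" "spectral_norm A \<le> a" "spectral_norm B \<le> b"
  shows "spectral_norm (A - B) \<le> a + b"
  using spectral_norm_minus[OF assms(1,2)] assms(3,4) by simp

lemma spectral_norm_smult_mono:
  assumes "cmod c \<le> k" "spectral_norm A \<le> a"
  shows "spectral_norm (c \<cdot>\<^sub>m A) \<le> k * a"
  using spectral_norm_smult_le[of c A] mult_mono[OF assms] order_trans[OF norm_ge_zero assms(1)] by simp

lemma spectral_norm_isometry_le:
  assumes "mat_adjoint J * J = 1\<^sub>m n"
  shows "spectral_norm J \<le> 1"
proof -
  have "(spectral_norm J)\<^sup>2 \<le> spectral_norm (1\<^sub>m n)"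
    using spectral_norm_sq_le[of "mat_adjoint J"] assms by simp
  also have "\<dots> \<le> 1\<^sup>2" using spectral_norm_one_le by simp
  finally show ?thesis by (rule power2_le_imp_le) simp
qed

section \<open>Inverses\<close>

lemma invertible_mat_inv_mat:
  assumes A: "A \<in> carrier_mat n n" and inv: "invertible_mat A"
  shows "inv_mat A \<in> carrier_mat n n" "A * inv_mat A = 1\<^sub>m n" "inv_mat A * A = 1\<^sub>m n"
proof -
  obtain B where B: "A * B = 1\<^sub>m n" "B * A = 1\<^sub>m (dim_row B)"
    using inv A by (auto simp: invertible_mat_def inverts_mat_def)
  have "dim_col (A * B) = n" "dim_col (B * A) = dim_row B"
    using B by auto
  then have "B \<in> carrier_mat n n" using A by (intro carrier_matI) auto
  then have "A \<in> Units (ring_mat TYPE(complex) n ())"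
    using A B by (auto simp: Units_def ring_mat_def)
  then obtain C where "mat_inverse A = Some C"
    using mat_inverse(1)[OF A, of "()"] by (cases "mat_inverse A") auto
  then show "inv_mat A \<in> carrier_mat n n" "A * inv_mat A = 1\<^sub>m n" "inv_mat A * A = 1\<^sub>m n"
    using mat_inverse(2)[OF A] by (auto simp: inv_mat_def)
qed

lemma inv_mat_unique:
  assumes A: "A \<in> carrier_mat n n" and B: "B \<in> carrier_mat n n" and "A * B = 1\<^sub>m n" "B * A = 1\<^sub>m n"
  shows "inv_mat A = B" "invertible_mat A"
proof -
  show inv: "invertible_mat A"
    using assms carrier_matD[OF A] carrier_matD[OF B]
    by (auto simp: invertible_mat_def inverts_mat_def intro!: exI[of _ B])
  have "inv_mat A = (B * A) * inv_mat A"
    using assms invertible_mat_inv_mat[OF A inv] by simp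
  also have "\<dots> = B * (A * inv_mat A)"
    using assms invertible_mat_inv_mat[OF A inv] by (intro assoc_mult_mat) auto
  finally show "inv_mat A = B"
    using invertible_mat_inv_mat[OF A inv] B by simp
qed

lemma spectral_norm_inverse_ge:
  assumes "F * R = 1\<^sub>m n" "dim_col F = dim_row R" "0 < n"
  shows "1 \<le> spectral_norm F * spectral_norm R"
  using spectral_norm_one_ge[OF assms(3)] spectral_norm_mult[OF assms(2)] assms(1) by simp

text \<open>The resolvent identity, for an arbitrary change of the matrix.\<close>

lemma inverse_diff:
  fixes F :: "complex mat"
  assumes "F \<in> carrier_mat n n" "R \<in> carrier_mat n n" "F' \<in> carrier_mat n n" "R' \<in> carrier_mat n n"
    and "F * R = 1\<^sub>m n" "R' * F' = 1\<^sub>m n"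
  shows "F - F' = F * ((R' - R) * F')"
proof -
  have "F * ((R' - R) * F') = F * (R' * F') - F * R * F'"
    using assms(1-4) by (simp add: mat_laws)
  then show ?thesis using assms by simp
qed

lemma inv_norm_finite:
  assumes "A \<in> carrier_mat n n" "inv_norm A \<le> ereal h"
  shows "inv_mat A \<in> carrier_mat n n" "A * inv_mat A = 1\<^sub>m n" "inv_mat A * A = 1\<^sub>m n"
    "spectral_norm (inv_mat A) \<le> h" "inv_norm A = ereal (spectral_norm (inv_mat A))"
  using assms(2) invertible_mat_inv_mat[OF assms(1)] by (auto simp: inv_norm_def split: if_splits)

lemma inv_norm_nonneg: "0 \<le> inv_norm A"
  by (simp add: inv_norm_def)

section \<open>Blocks and diagonal matrices\<close>

text \<open>The columns of the identity matrix of size \<open>K\<close> with indices \<open>i0, ..., i0 + d - 1\<close>.\<close>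

definition selection :: "nat \<Rightarrow> nat \<Rightarrow> nat \<Rightarrow> complex mat" where
  "selection K i0 d = mat K d (\<lambda>(i, j). if i = i0 + j then 1 else 0)"

lemma selection_dims [simp]:
  "dim_row (selection K i0 d) = K" "dim_col (selection K i0 d) = d"
  by (simp_all add: selection_def)

lemma sum_if_mult:
  fixes f :: "nat \<Rightarrow> complex"
  shows "(\<Sum>k = 0..<d. (if k = a then 1 else 0) * f k) = (if a < d then f a else 0)"
    "(\<Sum>k = 0..<d. f k * (if k = a then 1 else 0)) = (if a < d then f a else 0)"
  by (simp_all add: if_distrib[of "\<lambda>x. x * _"] if_distrib[of "\<lambda>x. _ * x"] cong: if_cong)

lemma mult_selection:
  assumes "i0 + d \<le> K" "dim_col Y = K"
  shows "Y * selection K i0 d = mat (dim_row Y) d (\<lambda>(i, j). Y $$ (i, i0 + j))"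
  by (rule eq_matI) (use assms in \<open>auto simp: selection_def scalar_prod_def sum_if_mult\<close>)

lemma adjoint_selection_mult:
  assumes "i0 + d \<le> K" "dim_row Y = K"
  shows "mat_adjoint (selection K i0 d) * Y = mat d (dim_col Y) (\<lambda>(i, j). Y $$ (i0 + i, j))"
  by (rule eq_matI) (use assms in \<open>auto simp: selection_def scalar_prod_def sum_if_mult if_distrib[of cnj] cong: if_cong\<close>)

lemma selection_mult:
  assumes "dim_row Y = d"
  shows "selection K i0 d * Y =
    mat K (dim_col Y) (\<lambda>(i, j). if i0 \<le> i \<and> i < i0 + d then Y $$ (i - i0, j) else 0)"
proof (rule eq_matI)
  fix i j
  assume "i < dim_row (mat K (dim_col Y) (\<lambda>(i, j). if i0 \<le> i \<and> i < i0 + d then Y $$ (i - i0, j) else 0))"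
    "j < dim_col (mat K (dim_col Y) (\<lambda>(i, j). if i0 \<le> i \<and> i < i0 + d then Y $$ (i - i0, j) else 0))"
  then have ij: "i < K" "j < dim_col Y" by auto
  have "(selection K i0 d * Y) $$ (i, j) = (\<Sum>k = 0..<d. (if i = i0 + k then 1 else 0) * Y $$ (k, j))"
    using ij assms by (auto simp: selection_def scalar_prod_def)
  also have "\<dots> = (\<Sum>k = 0..<d. (if k = i - i0 then 1 else 0) * (if i0 \<le> i then Y $$ (k, j) else 0))"
    by (rule sum.cong) auto
  also have "\<dots> = (if i0 \<le> i \<and> i < i0 + d then Y $$ (i - i0, j) else 0)"
    unfolding sum_if_mult by auto
  finally show "(selection K i0 d * Y) $$ (i, j) =
      mat K (dim_col Y) (\<lambda>(i, j). if i0 \<le> i \<and> i < i0 + d then Y $$ (i - i0, j) else 0) $$ (i, j)"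
    using ij by simp
qed auto

lemma mult_adjoint_selection:
  assumes "dim_col Y = d"
  shows "Y * mat_adjoint (selection K i0 d) =
    mat (dim_row Y) K (\<lambda>(i, j). if i0 \<le> j \<and> j < i0 + d then Y $$ (i, j - i0) else 0)"
proof -
  have "Y * mat_adjoint (selection K i0 d) = mat_adjoint (selection K i0 d * mat_adjoint Y)"
    using assms by (simp add: mat_adjoint_mult)
  also have "\<dots> = mat (dim_row Y) K (\<lambda>(i, j). if i0 \<le> j \<and> j < i0 + d then Y $$ (i, j - i0) else 0)"
    using assms by (subst selection_mult) (auto intro!: eq_matI)
  finally show ?thesis .
qed

lemma block_diagonal_selection:
  assumes "D1 \<in> carrier_mat n n" "D2 \<in> carrier_mat r r"
  shows "selection (n + r) 0 n * D1 * mat_adjoint (selection (n + r) 0 n)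
       + selection (n + r) n r * D2 * mat_adjoint (selection (n + r) n r)
     = four_block_mat D1 (0\<^sub>m n r) (0\<^sub>m r n) D2"
  using assms by (auto simp: selection_mult mult_adjoint_selection intro!: eq_matI)

lemma selection_isometry:
  "i0 + d \<le> K \<Longrightarrow> mat_adjoint (selection K i0 d) * selection K i0 d = 1\<^sub>m d"
  by (auto simp: adjoint_selection_mult intro!: eq_matI) (auto simp: selection_def)

lemma selection_orthogonal:
  "n + r \<le> K \<Longrightarrow> mat_adjoint (selection K 0 n) * selection K n r = 0\<^sub>m n r"
  by (auto simp: adjoint_selection_mult intro!: eq_matI) (auto simp: selection_def)

lemma real_diag_dims [simp]:
  "dim_row (real_diag xs) = length xs" "dim_col (real_diag xs) = length xs"
  by (simp_all add: real_diag_def mat_diag_def)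

lemma real_diag_adjoint: "mat_adjoint (real_diag xs) = real_diag xs"
  by (rule eq_matI) (auto simp: real_diag_def mat_diag_def)

lemma norm_real_diag_le:
  assumes "0 \<le> c" "\<And>x. x \<in> set xs \<Longrightarrow> \<bar>x\<bar> \<le> c"
  shows "spectral_norm (real_diag xs) \<le> c"
  unfolding real_diag_def using assms by (intro spectral_norm_mat_diag_le) auto

lemma real_diag_minus_scalar:
  "real_diag xs - complex_of_real s \<cdot>\<^sub>m 1\<^sub>m (length xs) = real_diag (map (\<lambda>x. x - s) xs)"
  by (rule eq_matI) (auto simp: real_diag_def mat_diag_def)

lemma hna_Gamma_real_diag:
  "hna_Gamma (real_diag xs) s = real_diag (map (\<lambda>x. x\<^sup>2 - s\<^sup>2) xs)"
  unfolding hna_Gamma_def real_diag_dims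
  unfolding real_diag_def mat_diag_diag
  by (rule eq_matI) (auto simp: mat_diag_def power2_eq_square)

lemma invertible_real_diag:
  assumes "0 \<notin> set xs"
  shows "invertible_mat (real_diag xs)"
proof (rule inv_mat_unique(2))
  show "real_diag xs \<in> carrier_mat (length xs) (length xs)"
    "real_diag (map inverse xs) \<in> carrier_mat (length xs) (length xs)"
    by (auto intro!: carrier_matI)
  have nz: "xs ! i \<noteq> 0" if "i < length xs" for i using assms that nth_mem by metis
  show "real_diag xs * real_diag (map inverse xs) = 1\<^sub>m (length xs)"
    "real_diag (map inverse xs) * real_diag xs = 1\<^sub>m (length xs)"
    unfolding real_diag_def length_map mat_diag_diag
    by (auto simp: mat_diag_def nz intro!: eq_matI)
qed

section \<open>The error system is all-pass up to small terms\<close>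

text \<open>The partition is described by matrices \<^term>\<open>J1\<close> and \<^term>\<open>J2\<close> whose columns form an orthonormal
  basis that is split into two parts. The blocks of \<open>A\<close>, \<open>B\<close>, \<open>C\<close> are then products with \<^term>\<open>J1\<close>,
  \<^term>\<open>J2\<close> and their adjoints, so that the Lyapunov equations can be used as they stand instead of block
  by block.\<close>

locale balanced_partition =
  fixes K n r m p :: nat and A B C J1 J2 S T U :: "complex mat" and s :: real
  assumes carriers: "A \<in> carrier_mat K K" "B \<in> carrier_mat K m" "C \<in> carrier_mat p K"
    "J1 \<in> carrier_mat K n" "J2 \<in> carrier_mat K r" "S \<in> carrier_mat n n" "T \<in> carrier_mat r r"
    "U \<in> carrier_mat p m"
    and J1_isometry: "mat_adjoint J1 * J1 = 1\<^sub>m n"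
    and J2_isometry: "mat_adjoint J2 * J2 = 1\<^sub>m r"
    and J1_J2: "mat_adjoint J1 * J2 = 0\<^sub>m n r"
    and J_complete: "J1 * mat_adjoint J1 + J2 * mat_adjoint J2 = 1\<^sub>m K"
    and S_adjoint: "mat_adjoint S = S" and T_adjoint: "mat_adjoint T = T"
    and controllability: "controllability_lyapunov A B (J1 * S * mat_adjoint J1 + J2 * T * mat_adjoint J2)"
    and observability: "observability_lyapunov A C (J1 * S * mat_adjoint J1 + J2 * T * mat_adjoint J2)"
begin

definition P where "P = J1 * S * mat_adjoint J1 + J2 * T * mat_adjoint J2"
definition A11 where "A11 = mat_adjoint J1 * A * J1"
definition A21 where "A21 = mat_adjoint J2 * A * J1"
definition B1 where "B1 = mat_adjoint J1 * B"
definition B2 where "B2 = mat_adjoint J2 * B"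
definition C1 where "C1 = C * J1"
definition C2 where "C2 = C * J2"

abbreviation "\<Gamma> \<equiv> hna_Gamma S s"
abbreviation "\<Delta>1 \<equiv> B2 + mat_adjoint C2 * U"
abbreviation "\<Delta>2 \<equiv> 1\<^sub>m p - U * mat_adjoint U"
abbreviation "Ch \<equiv> hna_C S s B1 C1 U"
text \<open>The input matrix of the reduced system without the factor \<open>\<Gamma>\<^sup>-\<^sup>1\<close>. On the axis
  \<open>\<Gamma> (zI - A_hat)\<close> is the adjoint of \<open>X(z)\<close>, so that \<open>\<Gamma>\<^sup>-\<^sup>1\<close> disappears from the transfer
  function of the reduced system if the latter is written with the inverse of that adjoint.\<close>

definition N where "N = S * B1 + complex_of_real s \<cdot>\<^sub>m (mat_adjoint C1 * U)"

text \<open>In the ideal case, in which \<^term>\<open>T\<close> is \<^term>\<open>s\<close> times the identity, \<^term>\<open>\<Delta>1\<close> is zero and \<^term>\<open>U\<close> is a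
  coisometry, the following two matrices vanish. They collect the deviations from it: \<open>L2\<close> that of the
  relation between inputs and outputs (\<open>output_residual\<close>), and \<open>W\<close> that of the off-diagonal block of the
  Lyapunov equation of the error system (\<open>B_N_adjoint\<close>).\<close>

definition L2 where
  "L2 = (T - complex_of_real s \<cdot>\<^sub>m 1\<^sub>m r) * mat_adjoint C2 +
        complex_of_real s \<cdot>\<^sub>m (\<Delta>1 * mat_adjoint U) + complex_of_real s \<cdot>\<^sub>m (mat_adjoint C2 * \<Delta>2)"
definition W where
  "W = (T * T - complex_of_real (s\<^sup>2) \<cdot>\<^sub>m 1\<^sub>m r) * A21 + L2 * C1"

lemma dims [simp]:
  "dim_row A = K" "dim_col A = K" "dim_row B = K" "dim_col B = m" "dim_row C = p" "dim_col C = K"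
  "dim_row J1 = K" "dim_col J1 = n" "dim_row J2 = K" "dim_col J2 = r" "dim_row S = n" "dim_col S = n"
  "dim_row T = r" "dim_col T = r" "dim_row U = p" "dim_col U = m"
  using carriers by auto

lemma derived_dims [simp]:
  "dim_row P = K" "dim_col P = K" "dim_row A11 = n" "dim_col A11 = n" "dim_row A21 = r" "dim_col A21 = n"
  "dim_row B1 = n" "dim_col B1 = m" "dim_row B2 = r" "dim_col B2 = m"
  "dim_row C1 = p" "dim_col C1 = n" "dim_row C2 = p" "dim_col C2 = r"
  "dim_row \<Gamma> = n" "dim_col \<Gamma> = n" "dim_row Ch = p" "dim_col Ch = n" "dim_row N = n" "dim_col N = m"
  "dim_row L2 = r" "dim_col L2 = p" "dim_row W = r" "dim_col W = n"
  by (simp_all add: P_def A11_def A21_def B1_def B2_def C1_def C2_def hna_Gamma_def hna_C_def N_def L2_def W_def)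

lemma J2_J1: "mat_adjoint J2 * J1 = 0\<^sub>m r n"
  using arg_cong[OF J1_J2, of mat_adjoint] by (simp add: mat_adjoint_mult)

lemmas J_simps = J1_isometry J2_isometry J1_J2 J2_J1
  mult_cancel_dims[OF J1_isometry] mult_cancel_dims[OF J2_isometry]

lemma J_zero_left:
  "dim_row Y = r \<Longrightarrow> mat_adjoint J1 * (J2 * Y) = 0\<^sub>m n (dim_col Y)"
  "dim_row Y = n \<Longrightarrow> mat_adjoint J2 * (J1 * Y) = 0\<^sub>m r (dim_col Y)"
  by (simp_all flip: assoc_mult_mat_dims add: J1_J2 J2_J1 mat_laws)

lemma adjoint_simps [simp]:
  "mat_adjoint P = P" "mat_adjoint \<Gamma> = \<Gamma>"
   by (simp_all add: P_def hna_Gamma_def adjoint_laws S_adjoint T_adjoint mat_laws)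

lemma P_J1: "P * J1 = J1 * S"
  by (simp add: P_def mat_laws J_simps)

lemma controllability_eq: "B * mat_adjoint B = (-1) \<cdot>\<^sub>m (A * P) - P * mat_adjoint A"
proof (rule eq_matI)
  fix i j
  assume "i < dim_row ((-1) \<cdot>\<^sub>m (A * P) - P * mat_adjoint A)"
    "j < dim_col ((-1) \<cdot>\<^sub>m (A * P) - P * mat_adjoint A)"
  then have ij: "i < K" "j < K" by simp_all
  have "(A * P + P * mat_adjoint A + B * mat_adjoint B) $$ (i, j) = 0\<^sub>m (dim_row A) (dim_row A) $$ (i, j)"
    using controllability by (simp add: controllability_lyapunov_def P_def)
  then show "(B * mat_adjoint B) $$ (i, j) = ((-1) \<cdot>\<^sub>m (A * P) - P * mat_adjoint A) $$ (i, j)"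
    using ij by (simp add: eq_neg_iff_add_eq_0 algebra_simps del: index_mult_mat(1))
qed simp_all

lemma observability_eq: "mat_adjoint C * C = (-1) \<cdot>\<^sub>m (mat_adjoint A * P) - P * A"
proof (rule eq_matI)
  fix i j
  assume "i < dim_row ((-1) \<cdot>\<^sub>m (mat_adjoint A * P) - P * A)"
    "j < dim_col ((-1) \<cdot>\<^sub>m (mat_adjoint A * P) - P * A)"
  then have ij: "i < K" "j < K" by simp_all
  have "(mat_adjoint A * P + P * A + mat_adjoint C * C) $$ (i, j) = 0\<^sub>m (dim_row A) (dim_row A) $$ (i, j)"
    using observability by (simp add: observability_lyapunov_def P_def)
  then show "(mat_adjoint C * C) $$ (i, j) = ((-1) \<cdot>\<^sub>m (mat_adjoint A * P) - P * A) $$ (i, j)"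
    using ij by (simp add: eq_neg_iff_add_eq_0 algebra_simps del: index_mult_mat(1))
qed simp_all

lemma J1_adjoint_P: "mat_adjoint J1 * P = S * mat_adjoint J1"
  using arg_cong[OF P_J1, of mat_adjoint] by (simp add: adjoint_laws S_adjoint)

lemma observability11: "mat_adjoint C1 * C1 = (-1) \<cdot>\<^sub>m (mat_adjoint A11 * S) - S * A11"
proof -
  have "mat_adjoint C1 * C1 = mat_adjoint J1 * (mat_adjoint C * C) * J1"
    by (simp add: C1_def adjoint_laws mat_laws)
  also have "\<dots> = (-1) \<cdot>\<^sub>m (mat_adjoint J1 * (mat_adjoint A * (P * J1))) - mat_adjoint J1 * P * (A * J1)"
    unfolding observability_eq by (simp add: mat_laws)
  also have "\<dots> = (-1) \<cdot>\<^sub>m (mat_adjoint A11 * S) - S * A11"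
    unfolding P_J1 J1_adjoint_P by (simp add: A11_def adjoint_laws mat_laws)
  finally show ?thesis .
qed

lemma Ch_adjoint: "mat_adjoint Ch = S * mat_adjoint C1 + complex_of_real s \<cdot>\<^sub>m (B1 * mat_adjoint U)"
  by (simp add: hna_C_def adjoint_laws S_adjoint)

lemma split_rows:
  assumes "dim_row Y = K"
  shows "Y = J1 * (mat_adjoint J1 * Y) + J2 * (mat_adjoint J2 * Y)"
proof -
  have "Y = (J1 * mat_adjoint J1 + J2 * mat_adjoint J2) * Y"
    unfolding J_complete using assms by (simp add: mat_laws)
  then show ?thesis using assms by (simp add: mat_laws)
qed

text \<open>Multiplying with the adjoint of \<^term>\<open>J1\<close> gives an exact relation, because the output matrix of the
  reduced system is chosen to satisfy it; the rest of the rows give \<^term>\<open>L2\<close>.\<close>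

lemma output_residual:
  "complex_of_real s \<cdot>\<^sub>m (B * mat_adjoint U) = J1 * mat_adjoint Ch + J2 * L2 - P * mat_adjoint C"
proof -
  let ?Y = "P * mat_adjoint C + complex_of_real s \<cdot>\<^sub>m (B * mat_adjoint U)"
  have "mat_adjoint J1 * ?Y = mat_adjoint Ch"
    unfolding Ch_adjoint unfolding P_def B1_def C1_def by (simp add: mat_laws adjoint_laws J_simps J_zero_left)
  moreover have "mat_adjoint J2 * ?Y = L2"
    unfolding P_def B2_def C2_def L2_def
    by (simp add: mat_laws adjoint_laws J_simps J_zero_left)
      (rule eq_matI, simp_all add: algebra_simps del: index_mult_mat(1))
  ultimately have "J1 * mat_adjoint Ch + J2 * L2 = ?Y"
    using split_rows[of ?Y] by simp
  then show ?thesis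
    by (simp only:) (rule eq_matI, simp_all del: index_mult_mat(1))
qed

abbreviation "X \<equiv> hna_X S s A11 B1 C1 U"

lemma X_dims [simp]: "dim_row (X z) = n" "dim_col (X z) = n"
  by (simp_all add: hna_X_def)

text \<open>The observability equation for the leading block replaces the term \<open>S A11\<^sup>* S\<close> of \<open>X\<close>. It is in
  this form that \<open>X\<close> arises from products with \<open>N\<^sup>*\<close>.\<close>

lemma X_eq: "X z = (-z) \<cdot>\<^sub>m \<Gamma> + \<Gamma> * A11 + mat_adjoint Ch * C1"
  unfolding hna_X_def Ch_adjoint
  by (simp add: mat_laws observability11 hna_Gamma_def)
    (rule eq_matI, simp_all add: algebra_simps power2_eq_square del: index_mult_mat(1))

lemma X_adjoint_eq:
  assumes "Re z = 0"
  shows "mat_adjoint (X z) = z \<cdot>\<^sub>m \<Gamma> + mat_adjoint A11 * \<Gamma> + mat_adjoint C1 * Ch"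
proof -
  have "cnj z = - z" using assms by (simp add: complex_eq_iff)
  then show ?thesis by (simp add: X_eq adjoint_laws)
qed

lemma N_adjoint: "mat_adjoint N = mat_adjoint B * (J1 * S) + complex_of_real s \<cdot>\<^sub>m (mat_adjoint U * C1)"
  by (simp add: N_def B1_def adjoint_laws S_adjoint mat_laws)

text \<open>This is the off-diagonal block of the controllability equation of the error system, multiplied by
  \<open>\<Gamma>\<close>. Both Lyapunov equations enter: controllability replaces \<open>B B\<^sup>*\<close>, and observability moves the
  resulting \<open>A\<^sup>* J1 S\<close> back to \<open>A J1\<close>. The gap between \<open>P\<^sup>2\<close> and \<open>s\<^sup>2 I\<close> is \<open>\<Gamma>\<close> in the leading block
  and small in the other one, where it contributes to \<open>W\<close>.\<close>

lemma B_N_adjoint: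
  "B * mat_adjoint N = (z \<cdot>\<^sub>m 1\<^sub>m K - A) * (J1 * \<Gamma>) + J1 * X z + J2 * W"
proof -
  have PS: "P * (J1 * S) = J1 * (S * S)"
    by (simp add: P_J1 mat_laws flip: assoc_mult_mat_dims)
  have AS: "mat_adjoint A * (J1 * S) = (-1) \<cdot>\<^sub>m (P * (A * J1)) - mat_adjoint C * C1"
  proof -
    have "mat_adjoint C * C1 = (mat_adjoint C * C) * J1"
      by (simp add: C1_def mat_laws)
    also have "\<dots> = (-1) \<cdot>\<^sub>m (mat_adjoint A * (J1 * S)) - P * (A * J1)"
      unfolding observability_eq by (simp add: mat_laws P_J1)
    finally show ?thesis
      by (simp only:) (rule eq_matI, simp_all del: index_mult_mat(1))
  qed
  have PPA: "P * (P * (A * J1)) = J1 * (S * (S * A11)) + J2 * (T * (T * A21))"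
    unfolding P_def A11_def A21_def by (simp add: mat_laws J_simps J_zero_left)
  have AJ: "A * J1 = J1 * A11 + J2 * A21"
    using split_rows[of "A * J1"] by (simp add: A11_def A21_def mat_laws)
  have "B * mat_adjoint N = (B * mat_adjoint B) * (J1 * S) + (complex_of_real s \<cdot>\<^sub>m (B * mat_adjoint U)) * C1"
    unfolding N_adjoint by (simp add: mat_laws)
  also have "\<dots> = (-1) \<cdot>\<^sub>m (A * (J1 * (S * S))) + (J1 * (S * (S * A11)) + J2 * (T * (T * A21)))
      + P * (mat_adjoint C * C1) + (J1 * (mat_adjoint Ch * C1) + J2 * (L2 * C1) - P * (mat_adjoint C * C1))"
    unfolding controllability_eq output_residual
    by (simp add: mat_laws PS AS flip: PPA) 
      (rule eq_matI, simp_all add: algebra_simps del: index_mult_mat(1))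
  also have "\<dots> = (z \<cdot>\<^sub>m 1\<^sub>m K - A) * (J1 * \<Gamma>) + J1 * X z + J2 * W"
    unfolding X_eq W_def hna_Gamma_def
    by (simp add: mat_laws AJ)
      (rule eq_matI, simp_all add: algebra_simps del: index_mult_mat(1))
  finally show ?thesis .
qed

text \<open>The controllability equation of the reduced system with Gramian \<open>S \<Gamma>\<^sup>-\<^sup>1\<close>, multiplied by \<open>\<Gamma>\<close> from
  both sides; the defect comes only from \<open>U U\<^sup>*\<close> not being the identity.\<close>

lemma N_N_adjoint:
  assumes "Re z = 0"
  shows "N * mat_adjoint N = mat_adjoint (X z) * S + S * X z
    - complex_of_real (s\<^sup>2) \<cdot>\<^sub>m (mat_adjoint C1 * (\<Delta>2 * C1))"
proof -
  have sUB: "complex_of_real s \<cdot>\<^sub>m (U * mat_adjoint B1) = Ch - C1 * S"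
    by (rule eq_matI) (simp_all add: hna_C_def del: index_mult_mat(1))
  have sUN: "complex_of_real s \<cdot>\<^sub>m (U * mat_adjoint N) = (Ch - C1 * S) * S
      + complex_of_real (s\<^sup>2) \<cdot>\<^sub>m (C1 - \<Delta>2 * C1)"
    unfolding sUB[symmetric] N_adjoint
    by (simp add: mat_laws B1_def adjoint_laws)
      (rule eq_matI, simp_all add: algebra_simps power2_eq_square del: index_mult_mat(1))
  have JBN: "mat_adjoint J1 * (B * mat_adjoint N) = z \<cdot>\<^sub>m \<Gamma> - A11 * \<Gamma> + X z"
  proof -
    have "mat_adjoint J1 * (A * (J1 * \<Gamma>)) = A11 * \<Gamma>"
      by (simp add: A11_def mat_laws)
    then show ?thesis
      unfolding B_N_adjoint[of z] by (simp add: mat_laws J_simps J_zero_left)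
  qed
  have "N * mat_adjoint N = S * (mat_adjoint J1 * (B * mat_adjoint N))
      + mat_adjoint C1 * (complex_of_real s \<cdot>\<^sub>m (U * mat_adjoint N))"
    by (simp add: N_def B1_def mat_laws)
  also have "\<dots> = z \<cdot>\<^sub>m (S * \<Gamma>) - S * (A11 * \<Gamma>) + S * X z + mat_adjoint C1 * (Ch * S)
      - (mat_adjoint C1 * C1) * (S * S) + complex_of_real (s\<^sup>2) \<cdot>\<^sub>m (mat_adjoint C1 * C1)
      - complex_of_real (s\<^sup>2) \<cdot>\<^sub>m (mat_adjoint C1 * (\<Delta>2 * C1))"
    unfolding sUN JBN
    by (simp add: mat_laws) (rule eq_matI, simp_all add: algebra_simps del: index_mult_mat(1))
  also have "\<dots> = mat_adjoint (X z) * S + S * X z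
    - complex_of_real (s\<^sup>2) \<cdot>\<^sub>m (mat_adjoint C1 * (\<Delta>2 * C1))"
    unfolding observability11 X_adjoint_eq[OF assms] hna_Gamma_def
    by (simp add: mat_laws) (rule eq_matI, simp_all add: algebra_simps del: index_mult_mat(1))
  finally show ?thesis .
qed

lemma N_U_adjoint:
  "complex_of_real s \<cdot>\<^sub>m (N * mat_adjoint U) =
   S * mat_adjoint Ch - \<Gamma> * mat_adjoint C1 - complex_of_real (s\<^sup>2) \<cdot>\<^sub>m (mat_adjoint C1 * \<Delta>2)"
  unfolding N_def Ch_adjoint hna_Gamma_def
  by (simp add: mat_laws)
    (rule eq_matI, simp_all add: algebra_simps power2_eq_square del: index_mult_mat(1))

text \<open>On the axis, \<open>z I - A\<close> and its adjoint add up to \<open>- A - A\<^sup>*\<close>. Hence the controllability equation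
  splits \<open>B B\<^sup>*\<close> into \<open>R P + P R\<^sup>*\<close> with \<open>R = z I - A\<close>, and both summands lose a resolvent in
  \<open>F B B\<^sup>* F\<^sup>*\<close>. The identities above do the same for the other products. Expanding \<open>E E\<^sup>*\<close> then leaves
  the terms \<open>a\<close>, \<open>b\<close>, \<open>c\<close>, \<open>e\<close> of the proof, which cancel, and the residual terms
  \<open>\<phi>\<close>, \<open>\<delta>\<close>, \<open>\<gamma>\<close>, each of which contains \<open>L2\<close>, \<open>W\<close> or \<open>\<Delta>2\<close>. In the ideal case
  the error is \<open>s\<close> times an all-pass function.\<close>

lemma error_identity:
  assumes z: "Re z = 0"
    and F: "F \<in> carrier_mat K K" "F * (z \<cdot>\<^sub>m 1\<^sub>m K - A) = 1\<^sub>m K"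
    and \<Psi>: "\<Psi> \<in> carrier_mat n n" "\<Psi> * mat_adjoint (X z) = 1\<^sub>m n"
  defines "E \<equiv> complex_of_real s \<cdot>\<^sub>m U + C * F * B - Ch * \<Psi> * N"
    and "\<phi> \<equiv> C * F * (J2 * L2)" and "\<delta> \<equiv> C * F * (J2 * W) * (mat_adjoint \<Psi> * mat_adjoint Ch)"
    and "\<gamma> \<equiv> Ch * \<Psi> * mat_adjoint C1 * \<Delta>2"
  shows "E * mat_adjoint E = complex_of_real (s\<^sup>2) \<cdot>\<^sub>m (U * mat_adjoint U)
     + (\<phi> + mat_adjoint \<phi>) - (\<delta> + mat_adjoint \<delta>) + complex_of_real (s\<^sup>2) \<cdot>\<^sub>m (\<gamma> + mat_adjoint \<gamma>)
     - complex_of_real (s\<^sup>2) \<cdot>\<^sub>m (\<gamma> * (C1 * (mat_adjoint \<Psi> * mat_adjoint Ch)))"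
proof -
  note Fd [simp] = carrier_matD[OF F(1)] carrier_matD[OF \<Psi>(1)]
  define R where "R = z \<cdot>\<^sub>m 1\<^sub>m K - A"
  have [simp]: "dim_row R = K" "dim_col R = K" by (simp_all add: R_def)
  have FR: "F * R = 1\<^sub>m K" using F(2) by (simp add: R_def)
  have F': "mat_adjoint R * mat_adjoint F = 1\<^sub>m K"
    using arg_cong[OF FR, of mat_adjoint] by (simp add: mat_adjoint_mult)
  have \<Psi>': "X z * mat_adjoint \<Psi> = 1\<^sub>m n"
    using arg_cong[OF \<Psi>(2), of mat_adjoint] by (simp add: mat_adjoint_mult)
  have BB: "B * mat_adjoint B = R * P + P * mat_adjoint R"
    unfolding controllability_eq R_def using z
    by (simp add: adjoint_laws mat_laws)
      (rule eq_matI, simp_all add: algebra_simps complex_eq_iff del: index_mult_mat(1))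
  note cancel = mult_cancel_dims[OF FR] mult_cancel_dims[OF \<Psi>(2)]
    mult_cancel_dims[OF F'] mult_cancel_dims[OF \<Psi>']
  define V where "V = C * F * B"
  define Q where "Q = Ch * \<Psi> * N"
  define a where "a = C * (F * (P * mat_adjoint C))"
  define b where "b = C1 * (\<Gamma> * (mat_adjoint \<Psi> * mat_adjoint Ch))"
  define c where "c = C * (F * (J1 * mat_adjoint Ch))"
  define e where "e = Ch * (\<Psi> * (S * mat_adjoint Ch))"
  have [simp]: "dim_row V = p" "dim_col V = m" "dim_row Q = p" "dim_col Q = m"
    "dim_row a = p" "dim_col a = p" "dim_row b = p" "dim_col b = p" "dim_row c = p" "dim_col c = p"
    "dim_row e = p" "dim_col e = p" "dim_row \<phi> = p" "dim_col \<phi> = p" "dim_row \<delta> = p" "dim_col \<delta> = p"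
    "dim_row \<gamma> = p" "dim_col \<gamma> = p"
    by (simp_all add: V_def Q_def a_def b_def c_def e_def \<phi>_def \<delta>_def \<gamma>_def)
  have VV: "V * mat_adjoint V = a + mat_adjoint a"
  proof -
    have "V * mat_adjoint V = C * (F * ((B * mat_adjoint B) * (mat_adjoint F * mat_adjoint C)))"
      by (simp add: V_def adjoint_laws mat_laws)
    also have "\<dots> = C * (F * (R * (P * (mat_adjoint F * mat_adjoint C))))
       + C * (F * (P * (mat_adjoint R * (mat_adjoint F * mat_adjoint C))))"
      unfolding BB by (simp add: mult_add_distrib_mat_dims add_mult_distrib_mat_dims assoc_mult_mat_dims)
    also have "\<dots> = mat_adjoint a + a"
      by (simp add: cancel a_def adjoint_laws mat_laws)
    finally show ?thesis by (simp add: comm_add_mat[of _ p p] carrier_matI)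
  qed
  have VQ: "V * mat_adjoint Q = b + c + \<delta>"
  proof -
    have "V * mat_adjoint Q = C * (F * ((B * mat_adjoint N) * (mat_adjoint \<Psi> * mat_adjoint Ch)))"
      by (simp add: V_def Q_def adjoint_laws mat_laws)
    also have "\<dots> = C * (F * (R * (J1 * (\<Gamma> * (mat_adjoint \<Psi> * mat_adjoint Ch)))))
       + C * (F * (J1 * (X z * (mat_adjoint \<Psi> * mat_adjoint Ch))))
       + C * (F * (J2 * (W * (mat_adjoint \<Psi> * mat_adjoint Ch))))"
      unfolding B_N_adjoint[of z] R_def[symmetric]
      by (simp add: mult_add_distrib_mat_dims add_mult_distrib_mat_dims assoc_mult_mat_dims)
    also have "\<dots> = b + c + \<delta>"
    proof -
      have "C * (J1 * Y) = C1 * Y" if "dim_row Y = n" for Y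
        using that by (simp add: C1_def assoc_mult_mat_dims)
      then show ?thesis by (simp add: cancel b_def c_def \<delta>_def assoc_mult_mat_dims)
    qed
    finally show ?thesis .
  qed
  have QQ: "Q * mat_adjoint Q = e + mat_adjoint e
      - complex_of_real (s\<^sup>2) \<cdot>\<^sub>m (\<gamma> * (C1 * (mat_adjoint \<Psi> * mat_adjoint Ch)))"
  proof -
    have "Q * mat_adjoint Q = Ch * (\<Psi> * ((N * mat_adjoint N) * (mat_adjoint \<Psi> * mat_adjoint Ch)))"
      by (simp add: Q_def adjoint_laws mat_laws)
    also have "\<dots> = Ch * (\<Psi> * (mat_adjoint (X z) * (S * (mat_adjoint \<Psi> * mat_adjoint Ch))))
       + Ch * (\<Psi> * (S * (X z * (mat_adjoint \<Psi> * mat_adjoint Ch))))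
       - complex_of_real (s\<^sup>2) \<cdot>\<^sub>m (\<gamma> * (C1 * (mat_adjoint \<Psi> * mat_adjoint Ch)))"
      unfolding N_N_adjoint[OF z] \<gamma>_def
      by (simp add: mult_add_distrib_mat_dims add_mult_distrib_mat_dims assoc_mult_mat_dims
        mult_minus_distrib_mat_dims[of _ _ Ch] mult_minus_distrib_mat_dims[of _ _ \<Psi>]
        minus_mult_distrib_mat_dims[of _ _ "mat_adjoint \<Psi> * mat_adjoint Ch"]
        smult_mult_mat_dims mult_smult_mat_dims)
    also have "\<dots> = mat_adjoint e + e
       - complex_of_real (s\<^sup>2) \<cdot>\<^sub>m (\<gamma> * (C1 * (mat_adjoint \<Psi> * mat_adjoint Ch)))"
      by (simp add: cancel e_def adjoint_laws S_adjoint assoc_mult_mat_dims)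
    finally show ?thesis by (simp add: comm_add_mat[of _ p p] carrier_matI)
  qed
  have VU: "complex_of_real s \<cdot>\<^sub>m (V * mat_adjoint U) = c - a + \<phi>"
  proof -
    have "complex_of_real s \<cdot>\<^sub>m (V * mat_adjoint U) = C * (F * (complex_of_real s \<cdot>\<^sub>m (B * mat_adjoint U)))"
      by (simp add: V_def mat_laws)
    also have "\<dots> = c - a + \<phi>"
      unfolding output_residual c_def a_def \<phi>_def
      by (simp add: mat_laws)
        (rule eq_matI, simp_all add: algebra_simps del: index_mult_mat(1))
    finally show ?thesis .
  qed
  have QU: "complex_of_real s \<cdot>\<^sub>m (Q * mat_adjoint U) = e - mat_adjoint b - complex_of_real (s\<^sup>2) \<cdot>\<^sub>m \<gamma>"
  proof -
    have "complex_of_real s \<cdot>\<^sub>m (Q * mat_adjoint U) = Ch * (\<Psi> * (complex_of_real s \<cdot>\<^sub>m (N * mat_adjoint U)))"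
      by (simp add: Q_def mat_laws)
    also have "\<dots> = e - mat_adjoint b - complex_of_real (s\<^sup>2) \<cdot>\<^sub>m \<gamma>"
      unfolding N_U_adjoint e_def b_def \<gamma>_def
      by (simp add: mult_minus_distrib_mat_dims[of _ _ Ch] mult_minus_distrib_mat_dims[of _ _ \<Psi>]
          mult_smult_mat_dims assoc_mult_mat_dims adjoint_laws)
    finally show ?thesis .
  qed
  have UV: "complex_of_real s \<cdot>\<^sub>m (U * mat_adjoint V) = mat_adjoint c - mat_adjoint a + mat_adjoint \<phi>"
    using arg_cong[OF VU, of mat_adjoint] by (simp add: adjoint_laws)
  have UQ: "complex_of_real s \<cdot>\<^sub>m (U * mat_adjoint Q) = mat_adjoint e - b - complex_of_real (s\<^sup>2) \<cdot>\<^sub>m mat_adjoint \<gamma>"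
    using arg_cong[OF QU, of mat_adjoint] by (simp add: adjoint_laws)
  have QV: "Q * mat_adjoint V = mat_adjoint b + mat_adjoint c + mat_adjoint \<delta>"
    using arg_cong[OF VQ, of mat_adjoint] by (simp add: adjoint_laws)
  have "E * mat_adjoint E = complex_of_real (s\<^sup>2) \<cdot>\<^sub>m (U * mat_adjoint U)
     + complex_of_real s \<cdot>\<^sub>m (U * mat_adjoint V) + complex_of_real s \<cdot>\<^sub>m (V * mat_adjoint U)
     - complex_of_real s \<cdot>\<^sub>m (U * mat_adjoint Q) - complex_of_real s \<cdot>\<^sub>m (Q * mat_adjoint U)
     + V * mat_adjoint V - V * mat_adjoint Q - Q * mat_adjoint V + Q * mat_adjoint Q"
    unfolding E_def V_def[symmetric] Q_def[symmetric]
    by (simp add: adjoint_laws mat_laws)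
      (rule eq_matI, simp_all add: algebra_simps power2_eq_square del: index_mult_mat(1))
  also have "\<dots> = complex_of_real (s\<^sup>2) \<cdot>\<^sub>m (U * mat_adjoint U)
     + (\<phi> + mat_adjoint \<phi>) - (\<delta> + mat_adjoint \<delta>) + complex_of_real (s\<^sup>2) \<cdot>\<^sub>m (\<gamma> + mat_adjoint \<gamma>)
     - complex_of_real (s\<^sup>2) \<cdot>\<^sub>m (\<gamma> * (C1 * (mat_adjoint \<Psi> * mat_adjoint Ch)))"
    unfolding UV VU UQ QU VV VQ QV QQ
    by (rule eq_matI, simp_all add: algebra_simps del: index_mult_mat(1))
  finally show ?thesis .
qed

end

section \<open>Bounding the residual terms\<close>

text \<open>All five residual terms have to be bounded by a multiple of \<open>h x \<eta>\<close>, with \<open>\<eta> = e + QE + QU\<close>, or of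
  \<open>x2 QU\<close>. Terms in which \<open>h\<close> or \<open>x\<close> is missing get it from \<open>1 \<le> a h\<close> or \<open>1 \<le> x X0\<close>, at the
  price of the factor \<open>a\<close> or of the bound for \<open>X0\<close>. No variable then occurs with an exponent above 4,
  and since all caps are at least 1, each monomial is at most the product of the fourth powers. The
  constant is 25 = 3 + 2 * 3 + 2 * 6 + 2 * 2, from the terms with \<open>h x \<eta>\<close>.\<close>

lemma error_budget:
  fixes a b c t u h x xi x2 e QE QU s L W Ch X0 :: real
  assumes caps: "1 \<le> a" "1 \<le> b" "1 \<le> c" "1 \<le> t" "1 \<le> u"
    and nonneg: "0 \<le> h" "0 \<le> x" "0 \<le> xi" "0 \<le> e" "0 \<le> QE" "0 \<le> QU" "0 \<le> s" "0 \<le> L" "0 \<le> W" "0 \<le> Ch"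
    and s: "s \<le> t" and ah: "1 \<le> a * h" and xX: "1 \<le> x * X0" and X0: "X0 \<le> 3 * (t\<^sup>2 * a * b * c * u)"
    and xi: "xi \<le> x" "xi\<^sup>2 \<le> x2"
    and L: "L \<le> e * c + t * (QE * u) + t * (c * QU)"
    and W: "W \<le> 2 * t * e * a + L * c"
    and Ch: "Ch \<le> c * t + t * (u * b)"
  shows "s\<^sup>2 * (1 + QU) + 2 * (c * h * L) + 2 * (c * h * W * (xi * Ch)) + s\<^sup>2 * (2 * (Ch * xi * c * QU))
      + s\<^sup>2 * (Ch * xi * c * QU * (c * (xi * Ch)))
    \<le> s\<^sup>2 + 25 * (a^4 * b^4 * c^4 * t^4 * u^4) * (h * x * (e + QE + QU) + x2 * QU)"
proof -
  define D where "D = a^4 * b^4 * c^4 * t^4 * u^4"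
  define \<eta> where "\<eta> = e + QE + QU"
  note [simp] = nonneg
  have pos [simp]: "0 \<le> a" "0 \<le> b" "0 \<le> c" "0 \<le> t" "0 \<le> u" "0 \<le> \<eta>"
    using caps nonneg by (auto simp: \<eta>_def)
  have mon: "a^i * b^j * c^k * t^l * u^v \<le> D" if "i \<le> 4" "j \<le> 4" "k \<le> 4" "l \<le> 4" "v \<le> 4" for i j k l v
    unfolding D_def using that caps by (intro mult_mono power_increasing mult_nonneg_nonneg zero_le_power) auto
  have mon1: "a^i * b^j * c^k * t^l * u^v \<le> a^i' * b^j' * c^k' * t^l' * u^v'"
    if "i \<le> i'" "j \<le> j'" "k \<le> k'" "l \<le> l'" "v \<le> v'" for i j k l v i' j' k' l' v'
    using that caps by (intro mult_mono power_increasing mult_nonneg_nonneg zero_le_power) auto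
  have grow: "y \<le> y * f" if "0 \<le> y" "1 \<le> f" for y f :: real
    using mult_left_mono[OF that(2,1)] by simp
  have L': "L \<le> c * t * u * \<eta>"
  proof -
    have "e * c \<le> e * (c * t * u)" using mon1[of 0 0 0 0 1 1 0 1 0 1] by (intro mult_left_mono) auto
    moreover have "QE * (t * u) \<le> QE * (c * t * u)" using mon1[of 0 0 0 0 0 1 1 1 1 1] by (intro mult_left_mono) auto
    moreover have "QU * (t * c) \<le> QU * (c * t * u)" using mon1[of 0 0 0 0 1 1 1 1 0 1] by (intro mult_left_mono) (auto simp: mult_ac)
    ultimately show ?thesis using L by (simp add: \<eta>_def algebra_simps)
  qed
  have Ch': "Ch \<le> 2 * (b * c * t * u)"
  proof -
    have "c * t \<le> b * c * t * u" using mon1[of 0 0 0 1 1 1 1 1 0 1] by simp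
    moreover have "t * (u * b) \<le> b * c * t * u" using mon1[of 0 0 1 1 0 1 1 1 1 1] by (simp add: mult_ac)
    ultimately show ?thesis using Ch by simp
  qed
  have W': "W \<le> 3 * (a * c\<^sup>2 * t * u * \<eta>)"
  proof -
    have "(a * t) * e \<le> (a * c\<^sup>2 * t * u) * \<eta>"
      by (rule mult_mono) (use mon1[of 1 1 0 0 0 2 1 1 0 1] in \<open>simp_all add: \<eta>_def\<close>)
    moreover have "L * c \<le> (c * t * u * \<eta>) * c" using L' by (intro mult_right_mono) auto
    moreover have "(c\<^sup>2 * t * u) * \<eta> \<le> (a * c\<^sup>2 * t * u) * \<eta>"
      by (rule mult_right_mono) (use mon1[of 0 1 0 0 2 2 1 1 1 1] in simp_all)
    ultimately show ?thesis using W by (simp add: algebra_simps power2_eq_square)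
  qed
  have xX': "1 \<le> 3 * (x * (t\<^sup>2 * a * b * c * u))"
    using xX mult_left_mono[OF X0, of x] by simp
  have QU\<eta>: "QU \<le> \<eta>" by (simp add: \<eta>_def)
  have x2: "0 \<le> x2"
    using order_trans[OF zero_le_power2 xi(2)] .
  have T1: "s\<^sup>2 * QU \<le> 3 * (D * (h * x * \<eta>))"
  proof -
    have "s\<^sup>2 * QU \<le> t\<^sup>2 * \<eta>" using s QU\<eta> by (intro mult_mono power_mono) auto
    also have "\<dots> \<le> t\<^sup>2 * \<eta> * ((a * h) * (3 * (x * (t\<^sup>2 * a * b * c * u))))"
      using mult_mono[OF ah xX'] by (intro grow) auto
    also have "\<dots> = 3 * ((a^2 * b^1 * c^1 * t^4 * u^1) * (h * x * \<eta>))"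
      by (simp add: power2_eq_square power4_eq_xxxx)
    also have "\<dots> \<le> 3 * (D * (h * x * \<eta>))"
      by (intro mult_left_mono mult_right_mono mon) auto
    finally show ?thesis .
  qed
  have T2: "c * h * L \<le> 3 * (D * (h * x * \<eta>))"
  proof -
    have "c * h * L \<le> c * h * (c * t * u * \<eta>)" using L' by (intro mult_left_mono) auto
    also have "\<dots> \<le> c * h * (c * t * u * \<eta>) * (3 * (x * (t\<^sup>2 * a * b * c * u)))"
      using xX' by (intro grow) auto
    also have "\<dots> = 3 * ((a^1 * b^1 * c^3 * t^3 * u^2) * (h * x * \<eta>))"
      by (simp add: power2_eq_square power3_eq_cube)
    also have "\<dots> \<le> 3 * (D * (h * x * \<eta>))"
      by (intro mult_left_mono mult_right_mono mon) auto
    finally show ?thesis .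
  qed
  have T3: "c * h * W * (xi * Ch) \<le> 6 * (D * (h * x * \<eta>))"
  proof -
    have "c * h * W * (xi * Ch) \<le> c * h * (3 * (a * c\<^sup>2 * t * u * \<eta>)) * (x * (2 * (b * c * t * u)))"
      using W' Ch' xi(1) by (intro mult_mono) auto
    also have "\<dots> = 6 * ((a^1 * b^1 * c^4 * t^2 * u^2) * (h * x * \<eta>))"
      by (simp add: power2_eq_square power4_eq_xxxx)
    also have "\<dots> \<le> 6 * (D * (h * x * \<eta>))"
      by (intro mult_left_mono mult_right_mono mon) auto
    finally show ?thesis .
  qed
  have T4: "s\<^sup>2 * (Ch * xi * c * QU) \<le> 2 * (D * (h * x * \<eta>))"
  proof -
    have "s\<^sup>2 * (Ch * xi * c * QU) \<le> t\<^sup>2 * ((2 * (b * c * t * u)) * x * c * \<eta>)"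
      using s Ch' xi(1) QU\<eta> by (intro mult_mono power_mono) auto
    also have "\<dots> \<le> t\<^sup>2 * ((2 * (b * c * t * u)) * x * c * \<eta>) * (a * h)"
      using ah by (intro grow) auto
    also have "\<dots> = 2 * ((a^1 * b^1 * c^2 * t^3 * u^1) * (h * x * \<eta>))"
      by (simp add: power2_eq_square power3_eq_cube)
    also have "\<dots> \<le> 2 * (D * (h * x * \<eta>))"
      by (intro mult_left_mono mult_right_mono mon) auto
    finally show ?thesis .
  qed
  have T5: "s\<^sup>2 * (Ch * xi * c * QU * (c * (xi * Ch))) \<le> 4 * (D * (x2 * QU))"
  proof -
    have "s\<^sup>2 * (Ch * xi * c * QU * (c * (xi * Ch))) = (s\<^sup>2 * Ch\<^sup>2 * c\<^sup>2) * (xi\<^sup>2 * QU)"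
      by (simp add: power2_eq_square)
    also have "\<dots> \<le> (t\<^sup>2 * (2 * (b * c * t * u))\<^sup>2 * c\<^sup>2) * (x2 * QU)"
      using s Ch' xi x2 by (intro mult_mono power_mono) auto
    also have "\<dots> = 4 * ((a^0 * b^2 * c^4 * t^4 * u^2) * (x2 * QU))"
      by (simp add: power2_eq_square power4_eq_xxxx)
    also have "\<dots> \<le> 4 * (D * (x2 * QU))"
      using x2 by (intro mult_left_mono mult_right_mono mon) auto
    finally show ?thesis .
  qed
  have "0 \<le> D * (h * x * \<eta>)" "0 \<le> D * (x2 * QU)"
    using x2 by (auto simp: D_def)
  then have "s\<^sup>2 * QU + 2 * (c * h * L) + 2 * (c * h * W * (xi * Ch)) + 2 * (s\<^sup>2 * (Ch * xi * c * QU))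
      + s\<^sup>2 * (Ch * xi * c * QU * (c * (xi * Ch)))
    \<le> 25 * (D * (h * x * \<eta>)) + 25 * (D * (x2 * QU))"
    using T1 T2 T3 T4 T5 by linarith
  then show ?thesis
    unfolding D_def[symmetric] \<eta>_def[symmetric] by (simp add: algebra_simps)
qed

context balanced_partition
begin

lemma norm_J: "spectral_norm J1 \<le> 1" "spectral_norm J2 \<le> 1"
  using J1_isometry J2_isometry by (auto intro: spectral_norm_isometry_le)

lemma norm_blocks:
  "spectral_norm A11 \<le> spectral_norm A" "spectral_norm A21 \<le> spectral_norm A"
  "spectral_norm B1 \<le> spectral_norm B" "spectral_norm C1 \<le> spectral_norm C" "spectral_norm C2 \<le> spectral_norm C"
proof -
  have J': "spectral_norm (mat_adjoint J1) \<le> 1" "spectral_norm (mat_adjoint J2) \<le> 1"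
    using norm_J by auto
  show "spectral_norm A11 \<le> spectral_norm A" "spectral_norm A21 \<le> spectral_norm A"
    unfolding A11_def A21_def
    using spectral_norm_mult_le[OF _ spectral_norm_mult_le[OF _ J'(1) order_refl] norm_J(1)]
      spectral_norm_mult_le[OF _ spectral_norm_mult_le[OF _ J'(2) order_refl] norm_J(1)] by auto
  show "spectral_norm B1 \<le> spectral_norm B" "spectral_norm C1 \<le> spectral_norm C" "spectral_norm C2 \<le> spectral_norm C"
    unfolding B1_def C1_def C2_def
    using spectral_norm_mult_le[OF _ J'(1) order_refl]
      spectral_norm_mult_le[OF _ order_refl norm_J(1)] spectral_norm_mult_le[OF _ order_refl norm_J(2)] by auto
qed

lemma norm_U_adjoint_le: "spectral_norm (U * mat_adjoint U) \<le> 1 + spectral_norm \<Delta>2"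
proof -
  have "U * mat_adjoint U = 1\<^sub>m p - \<Delta>2"
    by (rule eq_matI) (simp_all del: index_mult_mat(1))
  then show ?thesis
    using spectral_norm_minus_le[of "1\<^sub>m p" \<Delta>2, OF _ _ spectral_norm_one_le order_refl] by simp
qed

lemma norm_U: "spectral_norm U \<le> 1 + spectral_norm \<Delta>2"
proof (rule power2_le_imp_le)
  have "(spectral_norm U)\<^sup>2 \<le> 1 + spectral_norm \<Delta>2"
    using spectral_norm_sq_le[of U] norm_U_adjoint_le by simp
  also have "\<dots> \<le> (1 + spectral_norm \<Delta>2)\<^sup>2"
    by (rule self_le_power) auto
  finally show "(spectral_norm U)\<^sup>2 \<le> (1 + spectral_norm \<Delta>2)\<^sup>2" .
qed simp

text \<open>The two last hypotheses, which bound \<^term>\<open>h\<close> and \<^term>\<open>x\<close> from below, come from the point 0, whereas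
  \<^term>\<open>F\<close> and \<^term>\<open>\<Psi>\<close> are the resolvents at \<^term>\<open>z\<close>. This is why \<^term>\<open>h\<close> and \<^term>\<open>x\<close> are parameters and
  not the norms of \<^term>\<open>F\<close> and \<^term>\<open>\<Psi>\<close>.\<close>

lemma error_norm_bound:
  assumes z: "Re z = 0"
    and F: "F \<in> carrier_mat K K" "F * (z \<cdot>\<^sub>m 1\<^sub>m K - A) = 1\<^sub>m K" "spectral_norm F \<le> h"
    and \<Psi>: "\<Psi> \<in> carrier_mat n n" "\<Psi> * mat_adjoint (X z) = 1\<^sub>m n"
      "spectral_norm \<Psi> \<le> x" "(spectral_norm \<Psi>)\<^sup>2 \<le> x2"
    and s: "0 \<le> s" "s \<le> t" and S: "spectral_norm S \<le> t" and T: "spectral_norm T \<le> t"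
    and \<epsilon>: "0 \<le> \<epsilon>" "spectral_norm (T - complex_of_real s \<cdot>\<^sub>m 1\<^sub>m r) \<le> \<epsilon>"
    and ah: "1 \<le> spectral_norm A * h" and xX: "1 \<le> x * spectral_norm (X 0)"
  defines "E \<equiv> complex_of_real s \<cdot>\<^sub>m U + C * F * B - Ch * \<Psi> * N"
    and "D \<equiv> (1 + spectral_norm A)^4 * (1 + spectral_norm B)^4 * (1 + spectral_norm C)^4
           * (1 + t)^4 * (1 + spectral_norm \<Delta>2)^4"
  shows "(spectral_norm E)\<^sup>2 \<le> s\<^sup>2
    + 25 * D * (h * x * (\<epsilon> + spectral_norm \<Delta>1 + spectral_norm \<Delta>2) + x2 * spectral_norm \<Delta>2)"
proof -
  note [simp] = carrier_matD[OF F(1)] carrier_matD[OF \<Psi>(1)]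
  define a b c u \<tau> QU QE where "a = 1 + spectral_norm A" and "b = 1 + spectral_norm B"
    and "c = 1 + spectral_norm C" and "u = 1 + spectral_norm \<Delta>2" and "\<tau> = 1 + t"
    and "QU = spectral_norm \<Delta>2" and "QE = spectral_norm \<Delta>1"
  note norm_rules = spectral_norm_mult_le spectral_norm_add_le spectral_norm_minus_le spectral_norm_smult_mono
  have t: "0 \<le> t" using s by simp
  have h: "0 \<le> h" using order_trans[OF spectral_norm_nonneg F(3)] .
  have x: "0 \<le> x" using order_trans[OF spectral_norm_nonneg \<Psi>(3)] .
  have caps: "spectral_norm A11 \<le> a" "spectral_norm A21 \<le> a" "spectral_norm B1 \<le> b"
    "spectral_norm C \<le> c" "spectral_norm C1 \<le> c" "spectral_norm C2 \<le> c" "spectral_norm U \<le> u"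
    "spectral_norm S \<le> \<tau>" "spectral_norm T \<le> \<tau>" "cmod (complex_of_real s) \<le> \<tau>"
    using norm_blocks norm_U S T s unfolding a_def b_def c_def u_def \<tau>_def by auto
  have cQU: "0 \<le> c" "0 \<le> QU" by (auto simp: c_def QU_def)
  have s\<tau>: "s \<le> \<tau>" "0 \<le> \<tau>" using s by (auto simp: \<tau>_def)
  have Ch: "spectral_norm Ch \<le> c * \<tau> + \<tau> * (u * b)"
    unfolding hna_C_def by (intro norm_rules caps) (simp_all add: caps)
  have L2: "spectral_norm L2 \<le> \<epsilon> * c + \<tau> * (QE * u) + \<tau> * (c * QU)"
    unfolding L2_def by (intro norm_rules caps \<epsilon>) (simp_all add: caps QE_def QU_def)
  have W: "spectral_norm W \<le> 2 * \<tau> * \<epsilon> * a + spectral_norm L2 * c"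
  proof -
    have "T * T - complex_of_real (s\<^sup>2) \<cdot>\<^sub>m 1\<^sub>m r
      = (T - complex_of_real s \<cdot>\<^sub>m 1\<^sub>m r) * (T + complex_of_real s \<cdot>\<^sub>m 1\<^sub>m r)"
      by (simp add: mat_laws)
        (rule eq_matI, simp_all add: algebra_simps power2_eq_square del: index_mult_mat(1))
    moreover have "spectral_norm \<dots> \<le> \<epsilon> * (\<tau> + \<tau> * 1)"
      by (intro norm_rules \<epsilon> caps spectral_norm_one_le) (simp_all add: caps)
    ultimately have "spectral_norm (T * T - complex_of_real (s\<^sup>2) \<cdot>\<^sub>m 1\<^sub>m r) \<le> 2 * \<tau> * \<epsilon>"
      by (simp add: algebra_simps)
    then show ?thesis
      unfolding W_def by (intro norm_rules caps) simp_all
  qed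
  have X0: "spectral_norm (X 0) \<le> 3 * (\<tau>\<^sup>2 * a * b * c * u)"
  proof -
    have "X 0 = (complex_of_real s \<cdot>\<^sub>m (B1 * mat_adjoint U * C1) - complex_of_real s \<cdot>\<^sub>m (complex_of_real s \<cdot>\<^sub>m A11))
         - S * mat_adjoint A11 * S"
      unfolding hna_X_def
      by (rule eq_matI) (simp_all add: algebra_simps power2_eq_square del: index_mult_mat(1))
    also have "spectral_norm \<dots> \<le> (\<tau> * (b * u * c) + \<tau> * (\<tau> * a)) + \<tau> * a * \<tau>"
      by (intro norm_rules caps) (simp_all add: caps)
    also have "\<dots> \<le> 3 * (\<tau>\<^sup>2 * a * b * c * u)"
    proof -
      have one: "1 \<le> a" "1 \<le> b" "1 \<le> c" "1 \<le> u" "1 \<le> \<tau>"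
        using t by (auto simp: a_def b_def c_def u_def \<tau>_def)
      have "1 * (\<tau> * (b * u * c)) \<le> (\<tau> * a) * (\<tau> * (b * u * c))"
        using one mult_mono[of 1 \<tau> 1 a] by (intro mult_right_mono) auto
      moreover have "1 * (\<tau> * (\<tau> * a)) \<le> (b * c * u) * (\<tau> * (\<tau> * a))"
        using one mult_mono[of 1 "b * c" 1 u] mult_mono[of 1 b 1 c] by (intro mult_right_mono) auto
      ultimately show ?thesis by (simp add: power2_eq_square algebra_simps)
    qed
    finally show ?thesis .
  qed
  have ah': "1 \<le> a * h"
    using ah h by (simp add: a_def algebra_simps)
  define \<phi> where "\<phi> = C * F * (J2 * L2)"
  define \<delta> where "\<delta> = C * F * (J2 * W) * (mat_adjoint \<Psi> * mat_adjoint Ch)"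
  define \<gamma> where "\<gamma> = Ch * \<Psi> * mat_adjoint C1 * \<Delta>2"
  let ?xi = "spectral_norm \<Psi>" and ?Ch = "spectral_norm Ch"
  have \<phi>: "spectral_norm \<phi> \<le> c * h * (1 * spectral_norm L2)"
    unfolding \<phi>_def by (intro norm_rules caps F norm_J) simp_all
  have \<delta>: "spectral_norm \<delta> \<le> c * h * (1 * spectral_norm W) * (?xi * ?Ch)"
    unfolding \<delta>_def by (intro norm_rules caps F norm_J) simp_all
  have \<gamma>: "spectral_norm \<gamma> \<le> ?Ch * ?xi * c * QU"
    unfolding \<gamma>_def by (intro norm_rules) (simp_all add: caps QU_def)
  have [simp]: "dim_row \<phi> = p" "dim_col \<phi> = p" "dim_row \<delta> = p" "dim_col \<delta> = p" "dim_row \<gamma> = p" "dim_col \<gamma> = p"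
    by (simp_all add: \<phi>_def \<delta>_def \<gamma>_def)
  have "(spectral_norm E)\<^sup>2 \<le> spectral_norm (E * mat_adjoint E)"
    by (rule spectral_norm_sq_le)
  also have "E * mat_adjoint E = complex_of_real (s\<^sup>2) \<cdot>\<^sub>m (U * mat_adjoint U)
     + (\<phi> + mat_adjoint \<phi>) - (\<delta> + mat_adjoint \<delta>) + complex_of_real (s\<^sup>2) \<cdot>\<^sub>m (\<gamma> + mat_adjoint \<gamma>)
     - complex_of_real (s\<^sup>2) \<cdot>\<^sub>m (\<gamma> * (C1 * (mat_adjoint \<Psi> * mat_adjoint Ch)))"
    unfolding E_def \<phi>_def \<delta>_def \<gamma>_def by (rule error_identity[OF z F(1,2) \<Psi>(1,2)])
  also have "spectral_norm \<dots> \<le> s\<^sup>2 * (1 + QU)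
     + (spectral_norm \<phi> + spectral_norm \<phi>) + (spectral_norm \<delta> + spectral_norm \<delta>)
     + s\<^sup>2 * (spectral_norm \<gamma> + spectral_norm \<gamma>)
     + s\<^sup>2 * ((?Ch * ?xi * c * QU) * (c * (?xi * ?Ch)))"
    by (intro norm_rules \<gamma>) (simp_all add: caps QU_def norm_U_adjoint_le norm_power)
  also have "\<dots> \<le> s\<^sup>2 * (1 + QU) + 2 * (c * h * spectral_norm L2) + 2 * (c * h * spectral_norm W * (?xi * ?Ch))
      + s\<^sup>2 * (2 * (?Ch * ?xi * c * QU)) + s\<^sup>2 * (?Ch * ?xi * c * QU * (c * (?xi * ?Ch)))"
    using \<phi> \<delta> \<gamma> cQU by (intro add_mono mult_left_mono) auto
  also have "\<dots> \<le> s\<^sup>2 + 25 * (a^4 * b^4 * c^4 * \<tau>^4 * u^4) * (h * x * (\<epsilon> + QE + QU) + x2 * QU)"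
    by (rule error_budget[OF _ _ _ _ _ h x _ _ _ _ _ _ _ _ s\<tau>(1) ah' xX X0 \<Psi>(3,4) L2 W Ch])
      (use t s \<epsilon> in \<open>auto simp: a_def b_def c_def u_def \<tau>_def QE_def QU_def\<close>)
  finally show ?thesis
    unfolding D_def a_def b_def c_def u_def \<tau>_def QU_def QE_def .
qed

end

section \<open>Transfer functions on the imaginary axis\<close>

text \<open>The essential supremum of a non-measurable function is infinite, hence the continuity
  hypothesis.\<close>

lemma axis_norm_sq_le:
  assumes "continuous_on UNIV (\<lambda>y. spectral_norm (f (Complex 0 y)))"
    and "\<And>y. (spectral_norm (f (Complex 0 y)))\<^sup>2 \<le> b"
  shows "(axis_norm f)\<^sup>2 \<le> ereal b"
proof -
  have b: "0 \<le> b" using order_trans[OF zero_le_power2 assms(2)] .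
  let ?g = "\<lambda>y. ereal (spectral_norm (f (Complex 0 y)))"
  have meas: "?g \<in> borel_measurable lborel"
    using borel_measurable_continuous_onI[OF assms(1)] by simp
  have upper: "axis_norm f \<le> ereal (sqrt b)"
    unfolding axis_norm_def by (rule esssup_I[OF meas]) (auto simp: real_le_rsqrt assms(2))
  have "(0::ereal) = esssup lborel (\<lambda>y::real. 0)"
    by (rule esssup_const[symmetric]) simp
  also have "\<dots> \<le> axis_norm f"
    unfolding axis_norm_def by (rule esssup_mono) auto
  finally have "(axis_norm f)\<^sup>2 \<le> (ereal (sqrt b))\<^sup>2"
    unfolding power2_eq_square using upper b by (intro ereal_mult_mono) auto
  then show ?thesis using b by simp
qed

context balanced_partition
begin

abbreviation "reduced_transfer \<equiv> transfer (hna_A S s A11 B1 C1 U) (hna_B S s B1 C1 U) (hna_C S s B1 C1 U)"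

lemma hna_dims [simp]:
  assumes "invertible_mat \<Gamma>"
  shows "dim_row (hna_A S s A11 B1 C1 U) = n" "dim_col (hna_A S s A11 B1 C1 U) = n"
    "dim_row (hna_B S s B1 C1 U) = n" "dim_col (hna_B S s B1 C1 U) = m"
  using invertible_mat_inv_mat(1)[OF carrier_matI assms, of n]
  by (auto simp: hna_A_def hna_B_def)

text \<open>This is where \<open>X\<close> comes from: on the axis its adjoint is \<open>\<Gamma>\<close> times the matrix to be inverted in the transfer
  function of the reduced system.\<close>

lemma reduced_resolvent:
  assumes z: "Re z = 0" and \<Gamma>: "invertible_mat \<Gamma>"
    and \<Psi>: "\<Psi> \<in> carrier_mat n n" "\<Psi> * mat_adjoint (X z) = 1\<^sub>m n" "mat_adjoint (X z) * \<Psi> = 1\<^sub>m n"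
  shows "inv_mat (z \<cdot>\<^sub>m 1\<^sub>m n - hna_A S s A11 B1 C1 U) = \<Psi> * \<Gamma>"
proof (rule inv_mat_unique)
  note [simp] = carrier_matD[OF \<Psi>(1)]
  have \<Gamma>c: "\<Gamma> \<in> carrier_mat n n" by (intro carrier_matI) simp_all
  note inv = invertible_mat_inv_mat[OF \<Gamma>c \<Gamma>]
  note [simp] = carrier_matD[OF inv(1)]
  let ?R = "z \<cdot>\<^sub>m 1\<^sub>m n - hna_A S s A11 B1 C1 U"
  have zc: "cnj z = - z" using z by (simp add: complex_eq_iff)
  have \<Gamma>R: "\<Gamma> * ?R = mat_adjoint (X z)"
  proof -
    have "\<Gamma> * ?R = z \<cdot>\<^sub>m \<Gamma> - (complex_of_real (s\<^sup>2) \<cdot>\<^sub>m mat_adjoint A11 + S * A11 * S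
        - complex_of_real s \<cdot>\<^sub>m (mat_adjoint C1 * U * mat_adjoint B1))"
      using \<Gamma> by (simp add: mult_minus_distrib_mat_dims[of _ _ \<Gamma>] mult_smult_mat_dims mult_one_mat_dims)
        (simp add: hna_A_def mult_cancel_dims[OF inv(2)])
    also have "\<dots> = mat_adjoint (X z)"
      by (simp add: hna_X_def adjoint_laws zc S_adjoint mat_laws)
        (rule eq_matI, simp_all add: algebra_simps del: index_mult_mat(1))
    finally show ?thesis .
  qed
  have R: "?R = inv_mat \<Gamma> * mat_adjoint (X z)"
    unfolding \<Gamma>R[symmetric] using \<Gamma> by (simp add: mult_cancel_dims[OF inv(3)])
  show "?R \<in> carrier_mat n n" "\<Psi> * \<Gamma> \<in> carrier_mat n n"
    using \<Gamma> by (auto intro!: carrier_matI)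
  show "?R * (\<Psi> * \<Gamma>) = 1\<^sub>m n"
    unfolding R by (simp add: mat_laws mult_cancel_dims[OF \<Psi>(3)] inv(3))
  have "\<Psi> * \<Gamma> * ?R = \<Psi> * (\<Gamma> * ?R)"
    using \<Gamma> by (simp add: assoc_mult_mat_dims)
  then show "\<Psi> * \<Gamma> * ?R = 1\<^sub>m n"
    unfolding \<Gamma>R by (simp add: \<Psi>(2))
qed

lemma transfer_difference:
  assumes z: "Re z = 0" and \<Gamma>: "invertible_mat \<Gamma>" and D: "D \<in> carrier_mat p m"
    and \<Psi>: "\<Psi> \<in> carrier_mat n n" "\<Psi> * mat_adjoint (X z) = 1\<^sub>m n" "mat_adjoint (X z) * \<Psi> = 1\<^sub>m n"
    and F: "inv_mat (z \<cdot>\<^sub>m 1\<^sub>m K - A) \<in> carrier_mat K K"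
  shows "reduced_transfer (hna_D s D U) z - transfer A B C D z =
    (-1) \<cdot>\<^sub>m (complex_of_real s \<cdot>\<^sub>m U + C * inv_mat (z \<cdot>\<^sub>m 1\<^sub>m K - A) * B - Ch * \<Psi> * N)"
proof -
  note [simp] = carrier_matD[OF \<Psi>(1)] carrier_matD[OF D] carrier_matD[OF F]
  have \<Gamma>c: "\<Gamma> \<in> carrier_mat n n" by (intro carrier_matI) simp_all
  note inv = invertible_mat_inv_mat[OF \<Gamma>c \<Gamma>]
  note [simp] = carrier_matD[OF inv(1)]
  have "Ch * (\<Psi> * \<Gamma>) * hna_B S s B1 C1 U = Ch * \<Psi> * N"
    unfolding hna_B_def N_def[symmetric] by (simp add: assoc_mult_mat_dims mult_cancel_dims[OF inv(2)])
  then show ?thesis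
    unfolding transfer_def hna_D_def hna_dims[OF \<Gamma>] dims reduced_resolvent[OF z \<Gamma> \<Psi>]
    by (simp only:) (rule eq_matI, simp_all add: algebra_simps del: index_mult_mat(1))
qed

text \<open>The pointwise bound is \<open>error_norm_bound\<close>. For the essential supremum the error has to be measurable
  along the axis. The resolvent identity shows even Lipschitz continuity, since both resolvents are
  bounded there and the inverted matrices are affine in the frequency.\<close>

proposition axis_norm_error_bound:
  assumes \<Gamma>: "invertible_mat \<Gamma>" and D: "D \<in> carrier_mat p m" and pos: "0 < n" "0 < K"
    and A_res: "\<And>z. Re z = 0 \<Longrightarrow> inv_norm (z \<cdot>\<^sub>m 1\<^sub>m K - A) \<le> ereal h"
    and X_res: "\<And>z. Re z = 0 \<Longrightarrow> inv_norm (X z) \<le> ereal x"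
    and X_res2: "\<And>z. Re z = 0 \<Longrightarrow> (inv_norm (X z))\<^sup>2 \<le> ereal x2"
    and s: "0 \<le> s" "s \<le> t" and S: "spectral_norm S \<le> t" and T: "spectral_norm T \<le> t"
    and \<epsilon>: "0 \<le> \<epsilon>" "spectral_norm (T - complex_of_real s \<cdot>\<^sub>m 1\<^sub>m r) \<le> \<epsilon>"
  shows "(axis_norm (\<lambda>z. reduced_transfer (hna_D s D U) z - transfer A B C D z))\<^sup>2 \<le> ereal (s\<^sup>2
    + 25 * ((1 + spectral_norm A)^4 * (1 + spectral_norm B)^4 * (1 + spectral_norm C)^4
           * (1 + t)^4 * (1 + spectral_norm \<Delta>2)^4)
      * (h * x * (\<epsilon> + spectral_norm \<Delta>1 + spectral_norm \<Delta>2) + x2 * spectral_norm \<Delta>2))"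
proof (rule axis_norm_sq_le)
  define F where "F y = inv_mat (Complex 0 y \<cdot>\<^sub>m 1\<^sub>m K - A)" for y
  define \<Psi> where "\<Psi> y = mat_adjoint (inv_mat (X (Complex 0 y)))" for y
  define E where "E y = complex_of_real s \<cdot>\<^sub>m U + C * F y * B - Ch * \<Psi> y * N" for y
  have Rc: "z \<cdot>\<^sub>m 1\<^sub>m K - A \<in> carrier_mat K K" and Xc: "X z \<in> carrier_mat n n" for z
    by (auto intro!: carrier_matI)
  have F: "F y \<in> carrier_mat K K" "(Complex 0 y \<cdot>\<^sub>m 1\<^sub>m K - A) * F y = 1\<^sub>m K"
    "F y * (Complex 0 y \<cdot>\<^sub>m 1\<^sub>m K - A) = 1\<^sub>m K" "spectral_norm (F y) \<le> h" for y
    unfolding F_def using inv_norm_finite[OF Rc A_res] by auto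
  note Xinv = inv_norm_finite[OF Xc X_res]
  have \<Psi>: "\<Psi> y \<in> carrier_mat n n" "\<Psi> y * mat_adjoint (X (Complex 0 y)) = 1\<^sub>m n"
    "mat_adjoint (X (Complex 0 y)) * \<Psi> y = 1\<^sub>m n" "spectral_norm (\<Psi> y) \<le> x" for y
  proof -
    note X = Xinv[of "Complex 0 y", simplified]
    show "\<Psi> y \<in> carrier_mat n n" "spectral_norm (\<Psi> y) \<le> x"
      using X by (auto simp: \<Psi>_def)
    show "\<Psi> y * mat_adjoint (X (Complex 0 y)) = 1\<^sub>m n" "mat_adjoint (X (Complex 0 y)) * \<Psi> y = 1\<^sub>m n"
      using arg_cong[OF X(2), of mat_adjoint] arg_cong[OF X(3), of mat_adjoint] carrier_matD[OF X(1)]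
      by (auto simp: \<Psi>_def mat_adjoint_mult)
  qed
  have \<Psi>2: "(spectral_norm (\<Psi> y))\<^sup>2 \<le> x2" for y
    using X_res2[of "Complex 0 y"] Xinv(5)[of "Complex 0 y"] by (simp add: \<Psi>_def)
  note [simp] = carrier_matD[OF F(1)] carrier_matD[OF \<Psi>(1)]
  have [simp]: "dim_row (E y) = p" "dim_col (E y) = m" for y
    by (simp_all add: E_def)
  have eq: "reduced_transfer (hna_D s D U) (Complex 0 y) - transfer A B C D (Complex 0 y) = (-1) \<cdot>\<^sub>m E y" for y
    using transfer_difference[OF _ \<Gamma> D \<Psi>(1-3) F(1)[of y, unfolded F_def]] by (simp add: E_def F_def)
  have norm_eq: "spectral_norm ((-1) \<cdot>\<^sub>m E y) = spectral_norm (E y)" for y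
  proof (rule antisym)
    have "(-1) \<cdot>\<^sub>m ((-1) \<cdot>\<^sub>m E y) = E y" by (rule eq_matI) auto
    then show "spectral_norm (E y) \<le> spectral_norm ((-1) \<cdot>\<^sub>m E y)"
      using spectral_norm_smult_le[of "-1" "(-1) \<cdot>\<^sub>m E y"] by simp
    show "spectral_norm ((-1) \<cdot>\<^sub>m E y) \<le> spectral_norm (E y)"
      using spectral_norm_smult_le[of "-1" "E y"] by simp
  qed
  \<comment> \<open>The resolvent at 0 is the inverse of \<open>-A\<close>, so its norm is at least \<open>1 / |A|\<close>.\<close>
  have ah: "1 \<le> spectral_norm A * h"
  proof -
    have "1 \<le> spectral_norm (F 0) * spectral_norm (Complex 0 0 \<cdot>\<^sub>m 1\<^sub>m K - A)"
      using F(3)[of 0] pos(2) by (intro spectral_norm_inverse_ge) auto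
    also have "Complex 0 0 \<cdot>\<^sub>m 1\<^sub>m K - A = (-1) \<cdot>\<^sub>m A"
      by (rule eq_matI) (auto simp: zero_complex.code[symmetric])
    also have "spectral_norm (F 0) * spectral_norm ((-1) \<cdot>\<^sub>m A) \<le> h * spectral_norm A"
      using F(4)[of 0] spectral_norm_smult_le[of "-1" A] order_trans[OF spectral_norm_nonneg F(4)]
      by (intro mult_mono) auto
    finally show ?thesis by (simp add: mult_ac)
  qed
  have xX: "1 \<le> x * spectral_norm (X 0)"
  proof -
    have "1 \<le> spectral_norm (\<Psi> 0) * spectral_norm (mat_adjoint (X (Complex 0 0)))"
      using \<Psi>(2)[of 0] pos(1) by (intro spectral_norm_inverse_ge) auto
    also have "\<dots> \<le> x * spectral_norm (X 0)"
      using \<Psi>(4)[of 0] by (simp add: zero_complex.code[symmetric] mult_right_mono)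
    finally show ?thesis .
  qed
  show "(spectral_norm (reduced_transfer (hna_D s D U) (Complex 0 y) - transfer A B C D (Complex 0 y)))\<^sup>2 \<le> s\<^sup>2
    + 25 * ((1 + spectral_norm A)^4 * (1 + spectral_norm B)^4 * (1 + spectral_norm C)^4
           * (1 + t)^4 * (1 + spectral_norm \<Delta>2)^4)
      * (h * x * (\<epsilon> + spectral_norm \<Delta>1 + spectral_norm \<Delta>2) + x2 * spectral_norm \<Delta>2)" for y
    unfolding eq norm_eq unfolding E_def
    by (rule error_norm_bound[OF _ F(1,3,4) \<Psi>(1,2,4) \<Psi>2 s S T \<epsilon> ah xX]) simp
  define l where "l = spectral_norm C * (h * (1 * spectral_norm (1\<^sub>m K) * h)) * spectral_norm B
    + spectral_norm Ch * (x * (1 * spectral_norm \<Gamma> * x)) * spectral_norm N"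
  have h: "0 \<le> h" using order_trans[OF spectral_norm_nonneg F(4)] .
  have x: "0 \<le> x" using order_trans[OF spectral_norm_nonneg \<Psi>(4)] .
  note norm_rules = spectral_norm_mult_le spectral_norm_add_le spectral_norm_minus_le spectral_norm_smult_mono
  have diff: "spectral_norm (E y) \<le> spectral_norm (E y') + l * \<bar>y - y'\<bar>" for y y'
  proof -
    let ?d = "Complex 0 (y' - y)"
    have dF: "F y - F y' = F y * ((?d \<cdot>\<^sub>m 1\<^sub>m K) * F y')"
    proof -
      have "F y - F y' = F y * (((Complex 0 y' \<cdot>\<^sub>m 1\<^sub>m K - A) - (Complex 0 y \<cdot>\<^sub>m 1\<^sub>m K - A)) * F y')"
        by (rule inverse_diff[OF F(1) Rc F(1) Rc F(3,2)])
      also have "(Complex 0 y' \<cdot>\<^sub>m 1\<^sub>m K - A) - (Complex 0 y \<cdot>\<^sub>m 1\<^sub>m K - A) = ?d \<cdot>\<^sub>m 1\<^sub>m K"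
        by (rule eq_matI) (auto simp: complex_eq_iff)
      finally show ?thesis .
    qed
    have d\<Psi>: "\<Psi> y - \<Psi> y' = \<Psi> y * ((?d \<cdot>\<^sub>m \<Gamma>) * \<Psi> y')"
    proof -
      have "\<Psi> y - \<Psi> y' = \<Psi> y * ((mat_adjoint (X (Complex 0 y')) - mat_adjoint (X (Complex 0 y))) * \<Psi> y')"
        by (rule inverse_diff[OF \<Psi>(1) _ \<Psi>(1) _ \<Psi>(2,3)]) (auto intro!: carrier_matI)
      also have "mat_adjoint (X (Complex 0 y')) - mat_adjoint (X (Complex 0 y)) = ?d \<cdot>\<^sub>m \<Gamma>"
        by (subst (1 2) X_adjoint_eq, simp, simp)
          (rule eq_matI, simp_all add: complex_eq_iff algebra_simps del: index_mult_mat(1))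
      finally show ?thesis .
    qed
    have d: "cmod ?d \<le> \<bar>y - y'\<bar>" by (simp add: cmod_def)
    have "E y = E y' + (C * (F y - F y') * B - Ch * (\<Psi> y - \<Psi> y') * N)"
      unfolding E_def by (simp add: mat_laws)
        (rule eq_matI, simp_all del: index_mult_mat(1))
    also have "spectral_norm \<dots> \<le> spectral_norm (E y')
       + (spectral_norm C * (h * (\<bar>y - y'\<bar> * spectral_norm (1\<^sub>m K) * h)) * spectral_norm B
       + spectral_norm Ch * (x * (\<bar>y - y'\<bar> * spectral_norm \<Gamma> * x)) * spectral_norm N)"
      unfolding dF d\<Psi> by (intro norm_rules F(4) \<Psi>(4) d order_refl) simp_all
    also have "\<dots> = spectral_norm (E y') + l * \<bar>y - y'\<bar>"
      by (simp add: l_def algebra_simps)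
    finally show ?thesis .
  qed
  have "l-lipschitz_on UNIV (\<lambda>y. spectral_norm (E y))"
  proof (rule lipschitz_onI)
    show "0 \<le> l" using h x by (simp add: l_def)
    show "dist (spectral_norm (E y)) (spectral_norm (E y')) \<le> l * dist y y'" for y y'
      using diff[of y y'] diff[of y' y] by (simp add: dist_real_def abs_le_iff abs_minus_commute)
  qed
  then show "continuous_on UNIV (\<lambda>y. spectral_norm
      (reduced_transfer (hna_D s D U) (Complex 0 y) - transfer A B C D (Complex 0 y)))"
    unfolding eq norm_eq by (rule lipschitz_on_continuous_on)
qed

end

section \<open>A dominating polynomial of degree four\<close>

text \<open>The polynomial is \<open>c\<close> times the product of \<open>x i ^ 4 + 1\<close> over the variables in \<open>V\<close>. Multiplied
  out, its monomials are the products of fourth powers over the subsets of \<open>V\<close>, all with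
  coefficient \<open>c\<close>.\<close>

definition quartic_exponent :: "nat set \<Rightarrow> nat \<Rightarrow>\<^sub>0 nat" where
  "quartic_exponent I = Abs_poly_mapping (\<lambda>i. if i \<in> I then 4 else 0)"

definition quartic_product :: "nat set \<Rightarrow> real \<Rightarrow> real_mpoly" where
  "quartic_product V c = Abs_poly_mapping (\<lambda>\<mu>. if \<mu> \<in> quartic_exponent ` Pow V then c else 0)"

lemma lookup_quartic_exponent:
  "finite I \<Longrightarrow> Poly_Mapping.lookup (quartic_exponent I) i = (if i \<in> I then 4 else 0)"
  unfolding quartic_exponent_def by (subst lookup_Abs_poly_mapping) auto

lemma keys_quartic_exponent: "finite I \<Longrightarrow> Poly_Mapping.keys (quartic_exponent I) = I"
  by (auto simp: in_keys_iff lookup_quartic_exponent split: if_splits)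

lemma lookup_quartic_product:
  "finite V \<Longrightarrow> Poly_Mapping.lookup (quartic_product V c) \<mu> = (if \<mu> \<in> quartic_exponent ` Pow V then c else 0)"
  unfolding quartic_product_def by (subst lookup_Abs_poly_mapping) auto

lemma keys_quartic_product:
  "finite V \<Longrightarrow> c \<noteq> 0 \<Longrightarrow> Poly_Mapping.keys (quartic_product V c) = quartic_exponent ` Pow V"
  by (auto simp: in_keys_iff lookup_quartic_product split: if_splits)

lemma quartic_product_eval:
  assumes "finite V" "c \<noteq> 0"
  shows "mpoly_eval (quartic_product V c) x = c * (\<Prod>i\<in>V. x i ^ 4 + 1)"
proof -
  have fin: "finite I" if "I \<in> Pow V" for I using that assms(1) finite_subset by auto
  have inj: "inj_on quartic_exponent (Pow V)"
    by (rule inj_on_inverseI[of _ Poly_Mapping.keys]) (simp add: keys_quartic_exponent fin)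
  have "mpoly_eval (quartic_product V c) x = (\<Sum>I\<in>Pow V. c * (\<Prod>i\<in>I. x i ^ 4))"
    unfolding mpoly_eval_def keys_quartic_product[OF assms] sum.reindex[OF inj] comp_def
    by (rule sum.cong[OF refl])
      (simp add: lookup_quartic_product[OF assms(1)] keys_quartic_exponent lookup_quartic_exponent fin)
  also have "\<dots> = c * (\<Prod>i\<in>V. x i ^ 4 + 1)"
    using prod_add[OF assms(1), of "\<lambda>i. x i ^ 4" "\<lambda>_. 1"] by (simp add: sum_distrib_left)
  finally show ?thesis .
qed

lemma quartic_product_vars: "finite V \<Longrightarrow> c \<noteq> 0 \<Longrightarrow> mpoly_vars (quartic_product V c) \<subseteq> V"
  unfolding mpoly_vars_def by (auto simp: keys_quartic_product keys_quartic_exponent finite_subset)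

lemma quartic_product_degree:
  assumes "finite V" "c \<noteq> 0" "V \<noteq> {}"
  shows "mpoly_degree (quartic_product V c) = 4"
proof -
  have "(\<Union>\<mu>\<in>Poly_Mapping.keys (quartic_product V c). Poly_Mapping.lookup \<mu> ` Poly_Mapping.keys \<mu>)
     = (\<Union>I\<in>Pow V. (\<lambda>_. 4) ` I)"
    unfolding keys_quartic_product[OF assms(1,2)] image_image UN_simps
    using assms(1) by (intro SUP_cong image_cong) (auto simp: keys_quartic_exponent lookup_quartic_exponent finite_subset)
  also have "\<dots> = {4}" using assms(3) by auto
  finally show ?thesis by (simp add: mpoly_degree_def)
qed

lemma quartic_product_positive: "finite V \<Longrightarrow> 0 < c \<Longrightarrow> mpoly_positive_coeffs (quartic_product V c)"
  by (auto simp: mpoly_positive_coeffs_def keys_quartic_product lookup_quartic_product)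

text \<open>The bounds above contain powers of \<open>1 + x\<close>. The constant 8 is best possible, as \<open>x = 1\<close> shows, and
  the difference of both sides has the double root 1.\<close>

lemma power4_one_add_le: "(1 + x) ^ 4 \<le> 8 * (x ^ 4 + 1)" for x :: real
proof -
  have "8 * (x ^ 4 + 1) - (1 + x) ^ 4 = (x - 1)\<^sup>2 * (7 * x\<^sup>2 + 10 * x + 7)"
    by (simp add: power2_eq_square power4_eq_xxxx algebra_simps)
  also have "7 * x\<^sup>2 + 10 * x + 7 = 5 * (x + 1)\<^sup>2 + 2 * x\<^sup>2 + 2"
    by (simp add: power2_eq_square algebra_simps)
  also have "0 \<le> (x - 1)\<^sup>2 * (5 * (x + 1)\<^sup>2 + 2 * x\<^sup>2 + 2)" by simp
  finally show ?thesis by simp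
qed

section \<open>The error bound\<close>

lemma hna_U_carrier:
  assumes "hna_U \<gamma> r m p B2 C2 U"
  shows "U \<in> carrier_mat p m"
  using assms by (fastforce simp: hna_U_def is_svd_def unitary_mat_def Let_def intro: mult_carrier_mat)

text \<open>It remains to see the system as an instance of \<open>balanced_partition\<close>, with columns of the identity
  matrix as \<open>J1\<close> and \<open>J2\<close>. The choice of the cluster has two effects: outside it no singular value
  equals \<open>s\<close>, so that \<open>\<Gamma>\<close> is invertible, and inside it all of them are \<open>\<epsilon>\<close>-close to \<open>s\<close>.\<close>

lemma balanced_system_error_bound:
  fixes K m p k j1 j2 :: nat and A B C D U :: "complex mat" and \<sigma> :: "nat \<Rightarrow> real"
    and \<epsilon> h x x2 :: real
  defines "r \<equiv> j2 - j1 + 1"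
  defines "n \<equiv> K - r"
  defines "s \<equiv> \<sigma> (k + 1)" and "S \<equiv> Sigma1 K j1 j2 \<sigma>"
    and "A11 \<equiv> upper_left A n n" and "B1 \<equiv> upper_left B n m" and "B2 \<equiv> lower_right B n 0"
    and "C1 \<equiv> upper_left C p n" and "C2 \<equiv> lower_right C 0 n"
  defines "QE \<equiv> spectral_norm (B2 + mat_adjoint C2 * U)" and "QU \<equiv> spectral_norm (1\<^sub>m p - U * mat_adjoint U)"
    and "X \<equiv> hna_X S s A11 B1 C1 U"
  assumes sys: "stable_balanced_system K m p A B C D \<sigma> k \<epsilon> j1 j2" and rK: "r < K"
    and U: "U \<in> carrier_mat p m"
    and A_res: "\<And>z. Re z = 0 \<Longrightarrow> inv_norm (z \<cdot>\<^sub>m 1\<^sub>m K - A) \<le> ereal h"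
    and X_res: "\<And>z. Re z = 0 \<Longrightarrow> inv_norm (X z) \<le> ereal x"
    and X_res2: "\<And>z. Re z = 0 \<Longrightarrow> (inv_norm (X z))\<^sup>2 \<le> ereal x2"
  shows "(axis_norm (\<lambda>z. transfer (hna_A S s A11 B1 C1 U) (hna_B S s B1 C1 U) (hna_C S s B1 C1 U) (hna_D s D U) z
           - transfer A B C D z))\<^sup>2 \<le> ereal (s\<^sup>2
    + 25 * ((1 + spectral_norm A)^4 * (1 + spectral_norm B)^4 * (1 + spectral_norm C)^4
           * (1 + \<sigma> 1)^4 * (1 + QU)^4)
      * (h * x * (\<epsilon> + QE + QU) + x2 * QU))"
proof -
  define T where "T = Sigma2 j1 j2 \<sigma>"
  define xs where "xs = map \<sigma> ([1..<j1] @ [j2 + 1..<K + 1])"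
  define ys where "ys = map \<sigma> [j1..<j2 + 1]"
  have ST: "S = real_diag xs" "T = real_diag ys"
    by (simp_all add: S_def T_def xs_def ys_def Sigma1_def Sigma2_def)
  have carriers: "A \<in> carrier_mat K K" "B \<in> carrier_mat K m" "C \<in> carrier_mat p K" "D \<in> carrier_mat p m"
    and idx: "0 \<le> \<epsilon>" "1 \<le> j1" "j1 \<le> k + 1" "k + 1 \<le> j2" "j2 \<le> K"
    and cluster: "{j \<in> {1..K}. \<bar>\<sigma> j - s\<bar> \<le> \<epsilon>} = {j1..j2}"
    and hsv: "hankel_singular_values K A B C \<sigma>"
    and lyap: "controllability_lyapunov A B (four_block_mat S (0\<^sub>m n r) (0\<^sub>m r n) T)"
      "observability_lyapunov A C (four_block_mat S (0\<^sub>m n r) (0\<^sub>m r n) T)"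
    using sys by (auto simp: stable_balanced_system_def Let_def r_def n_def s_def S_def T_def)
  have len: "length xs = n" "length ys = r"
    using idx by (auto simp: xs_def ys_def n_def r_def)
  have K: "K = n + r" "n + r \<le> K" using rK by (auto simp: n_def)
  have \<sigma>: "0 \<le> \<sigma> j" "\<sigma> j \<le> \<sigma> 1" if "j \<in> {1..K}" for j
    using hsv that by (auto simp: hankel_singular_values_def)
  have s: "0 \<le> s" "s \<le> \<sigma> 1" using \<sigma>[of "k + 1"] idx by (auto simp: s_def)
  have xs: "0 \<le> x" "x \<le> \<sigma> 1" "x \<noteq> s" if "x \<in> set xs" for x
  proof -
    from that obtain j where j: "x = \<sigma> j" "j \<in> {1..K}" "j \<notin> {j1..j2}"
      using idx by (auto simp: xs_def)
    then show "0 \<le> x" "x \<le> \<sigma> 1" using \<sigma> by auto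
    have "j \<notin> {j \<in> {1..K}. \<bar>\<sigma> j - s\<bar> \<le> \<epsilon>}" using j cluster by simp
    then show "x \<noteq> s" using j idx by auto
  qed
  have ys: "0 \<le> y" "y \<le> \<sigma> 1" "\<bar>y - s\<bar> \<le> \<epsilon>" if "y \<in> set ys" for y
  proof -
    from that obtain j where j: "y = \<sigma> j" "j \<in> {j1..j2}"
      by (auto simp: ys_def)
    have "j \<in> {j \<in> {1..K}. \<bar>\<sigma> j - s\<bar> \<le> \<epsilon>}" using j cluster by simp
    then show "0 \<le> y" "y \<le> \<sigma> 1" "\<bar>y - s\<bar> \<le> \<epsilon>" using j \<sigma> by auto
  qed
  define J1 where "J1 = selection K 0 n"
  define J2 where "J2 = selection K n r"
  have P: "J1 * S * mat_adjoint J1 + J2 * T * mat_adjoint J2 = four_block_mat S (0\<^sub>m n r) (0\<^sub>m r n) T"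
    unfolding J1_def J2_def K(1) by (rule block_diagonal_selection) (auto simp: ST len intro!: carrier_matI)
  have complete: "J1 * mat_adjoint J1 + J2 * mat_adjoint J2 = 1\<^sub>m K"
    using block_diagonal_selection[OF one_carrier_mat one_carrier_mat, of n r]
    by (simp add: J1_def J2_def K(1) mat_laws four_block_one_mat)
  interpret bp: balanced_partition K n r m p A B C J1 J2 S T U s
  proof
    show "mat_adjoint J1 * J1 = 1\<^sub>m n" "mat_adjoint J2 * J2 = 1\<^sub>m r" "mat_adjoint J1 * J2 = 0\<^sub>m n r"
      using K by (auto simp: J1_def J2_def selection_isometry selection_orthogonal)
    show "controllability_lyapunov A B (J1 * S * mat_adjoint J1 + J2 * T * mat_adjoint J2)"
      "observability_lyapunov A C (J1 * S * mat_adjoint J1 + J2 * T * mat_adjoint J2)"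
      using lyap unfolding P by auto
  qed (use carriers U complete in \<open>auto simp: ST len J1_def J2_def real_diag_adjoint intro!: carrier_matI\<close>)
  have blocks: "bp.A11 = A11" "bp.B1 = B1" "bp.B2 = B2" "bp.C1 = C1" "bp.C2 = C2"
    unfolding bp.A11_def bp.B1_def bp.B2_def bp.C1_def bp.C2_def
    unfolding A11_def B1_def B2_def C1_def C2_def
      upper_left_def lower_right_def J1_def J2_def using K
    by (auto simp: adjoint_selection_mult mult_selection intro!: eq_matI)
  have \<Gamma>: "invertible_mat (hna_Gamma S s)"
    unfolding ST hna_Gamma_real_diag
  proof (rule invertible_real_diag)
    have "x\<^sup>2 \<noteq> s\<^sup>2" if "x \<in> set xs" for x
      using xs[OF that] s by (simp add: power2_eq_iff_nonneg)
    then show "0 \<notin> set (map (\<lambda>x. x\<^sup>2 - s\<^sup>2) xs)" by auto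
  qed
  have norms: "spectral_norm S \<le> \<sigma> 1" "spectral_norm T \<le> \<sigma> 1"
    "spectral_norm (T - complex_of_real s \<cdot>\<^sub>m 1\<^sub>m r) \<le> \<epsilon>"
    using xs ys s idx(1) unfolding len(2)[symmetric] ST real_diag_minus_scalar
    by (auto intro!: norm_real_diag_le)
  show ?thesis
    using bp.axis_norm_error_bound[unfolded blocks, OF \<Gamma> carriers(4) _ _ A_res
        X_res[unfolded X_def] X_res2[unfolded X_def] s norms(1,2) idx(1) norms(3)] rK
    unfolding QE_def QU_def n_def by simp
qed

theorem theorem4p2:
  "\<exists>R :: real_mpoly.
     mpoly_vars R \<subseteq> {..<6} \<and> mpoly_degree R = 4 \<and> mpoly_positive_coeffs R \<and>
     (\<forall>(K::nat) (m::nat) (p::nat) (A::complex mat) (B::complex mat) (C::complex mat) (D::complex mat)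
        (\<sigma> :: nat \<Rightarrow> real) (k::nat) (\<epsilon>::real) (j1::nat) (j2::nat) (\<gamma>::real) (U::complex mat) (\<rho>::real).
        let r = j2 - j1 + 1; n = K - r; s = \<sigma> (k + 1); S = Sigma1 K j1 j2 \<sigma>;
            A11 = upper_left A n n;
            B1 = upper_left B n m; B2 = lower_right B n 0;
            C1 = upper_left C p n; C2 = lower_right C 0 n;
            QE = spectral_norm (B2 + mat_adjoint C2 * U);
            QU = spectral_norm (1\<^sub>m p - U * mat_adjoint U);
            G = transfer A B C D;
            Gh = transfer (hna_A S s A11 B1 C1 U) (hna_B S s B1 C1 U) (hna_C S s B1 C1 U) (hna_D s D U);
            X = hna_X S s A11 B1 C1 U;
            x = (SUP z\<in>imag_axis. inv_norm (X z));
            x2 = (SUP z\<in>imag_axis. (inv_norm (X z))\<^sup>2);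
            M = mpoly_eval R
                  (\<lambda>i. [spectral_norm A, spectral_norm B, spectral_norm C, \<sigma> 1, 1 + QE, 1 + QU] ! i)
        in stable_balanced_system K m p A B C D \<sigma> k \<epsilon> j1 j2 \<longrightarrow> r < K \<longrightarrow>
           0 \<le> \<gamma> \<longrightarrow> hna_U \<gamma> r m p B2 C2 U \<longrightarrow>
           0 < \<rho> \<longrightarrow> imag_axis \<inter> pseudospectrum \<rho> A = {} \<longrightarrow>
           x < \<infinity> \<longrightarrow> x2 < \<infinity> \<longrightarrow>
           (axis_norm (\<lambda>z. Gh z - G z))\<^sup>2
             \<le> ereal (s\<^sup>2)
               + ereal M * (ereal (1 / \<rho>) * x * ereal (\<epsilon> + QE + QU)
                            + x2 * ereal QU
                            + ereal (1 / \<rho>\<^sup>2 * \<epsilon>)))"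
proof -
  \<comment> \<open>The constant is 25 times the fourth power of 8, one factor 8 for each of the four caps \<open>1 + x\<close>.\<close>
  define R where "R = quartic_product {..<6} 102400"
  \<comment> \<open>This step only converts the bound from real numbers with the caps to extended reals with the polynomial.\<close>
  have bound: "(axis_norm E)\<^sup>2 \<le> ereal (s\<^sup>2) + ereal (mpoly_eval R (\<lambda>i. [a, b, c, t, 1 + QE, 1 + QU] ! i))
      * (ereal (1 / \<rho>) * x * ereal (\<epsilon> + QE + QU) + x2 * ereal QU + ereal (1 / \<rho>\<^sup>2 * \<epsilon>))"
    if E: "\<And>xr x2r. x = ereal xr \<Longrightarrow> x2 = ereal x2r \<Longrightarrow> (axis_norm E)\<^sup>2 \<le> ereal (s\<^sup>2
        + 25 * ((1 + a)^4 * (1 + b)^4 * (1 + c)^4 * (1 + t)^4 * (1 + QU)^4)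
          * (1 / \<rho> * xr * (\<epsilon> + QE + QU) + x2r * QU))"
      and nonneg: "0 \<le> x" "0 \<le> x2" "0 \<le> \<epsilon>" "0 \<le> QE" "0 \<le> QU" "0 < \<rho>"
      and fin: "x < \<infinity>" "x2 < \<infinity>"
    for E and s a b c t QE QU \<rho> \<epsilon> :: real and x x2 :: ereal
  proof -
    obtain xr x2r where x: "x = ereal xr" "x2 = ereal x2r" "0 \<le> xr" "0 \<le> x2r"
      using nonneg(1,2) fin by (cases x; cases x2) auto
    let ?Q = "1 / \<rho> * xr * (\<epsilon> + QE + QU) + x2r * QU"
    let ?M = "mpoly_eval R (\<lambda>i. [a, b, c, t, 1 + QE, 1 + QU] ! i)"
    have Q: "0 \<le> ?Q" using nonneg x by auto
    have M: "?M = 102400 * ((a^4 + 1) * (b^4 + 1) * (c^4 + 1) * (t^4 + 1) * ((1 + QE)^4 + 1) * ((1 + QU)^4 + 1))"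
      unfolding R_def by (subst quartic_product_eval) (simp_all add: eval_nat_numeral mult_ac)
    have "25 * ((1 + a)^4 * (1 + b)^4 * (1 + c)^4 * (1 + t)^4 * 1 * (1 + QU)^4)
       \<le> 25 * ((8 * (a^4 + 1)) * (8 * (b^4 + 1)) * (8 * (c^4 + 1)) * (8 * (t^4 + 1)) * ((1 + QE)^4 + 1) * ((1 + QU)^4 + 1))"
      by (intro mult_left_mono mult_mono power4_one_add_le) auto
    also have "\<dots> = ?M"
    proof -
      have "25 * ((8 * A) * (8 * B) * (8 * C) * (8 * T) * E * F) = 102400 * (A * B * C * T * E * F)"
        for A B C T E F :: real by simp
      then show ?thesis unfolding M .
    qed
    finally have "25 * ((1 + a)^4 * (1 + b)^4 * (1 + c)^4 * (1 + t)^4 * (1 + QU)^4) * ?Q \<le> ?M * ?Q"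
      using Q by (intro mult_right_mono) auto
    also have "\<dots> \<le> ?M * (?Q + 1 / \<rho>\<^sup>2 * \<epsilon>)"
      using nonneg(3) by (intro mult_left_mono) (auto simp: M)
    finally have "(axis_norm E)\<^sup>2 \<le> ereal (s\<^sup>2 + ?M * (?Q + 1 / \<rho>\<^sup>2 * \<epsilon>))"
      by (intro order_trans[OF E[OF x(1,2)]]) simp
    then show ?thesis by (simp add: x)
  qed
  show ?thesis
    unfolding Let_def
  proof (intro exI[of _ R] conjI allI impI)
    show "mpoly_vars R \<subseteq> {..<6}" "mpoly_positive_coeffs R"
      by (simp_all add: R_def quartic_product_vars quartic_product_positive)
    have "{..<6 :: nat} \<noteq> {}"
      by (rule ex_in_conv[THEN iffD1], rule exI[of _ 0], simp)
    then show "mpoly_degree R = 4"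
      unfolding R_def by (intro quartic_product_degree) simp_all
  next
    fix K m p :: nat and A B C D :: "complex mat" and \<sigma> :: "nat \<Rightarrow> real" and k and \<epsilon> :: real
      and j1 j2 and \<gamma> :: real and U :: "complex mat" and \<rho> :: real
    let ?n = "K - (j2 - j1 + 1)"
    let ?X = "hna_X (Sigma1 K j1 j2 \<sigma>) (\<sigma> (k + 1)) (upper_left A ?n ?n) (upper_left B ?n m) (upper_left C p ?n) U"
    assume sys: "stable_balanced_system K m p A B C D \<sigma> k \<epsilon> j1 j2" and rK: "j2 - j1 + 1 < K"
      and U: "hna_U \<gamma> (j2 - j1 + 1) m p (lower_right B ?n 0) (lower_right C 0 ?n) U"
      and \<rho>: "0 < \<rho>" "imag_axis \<inter> pseudospectrum \<rho> A = {}"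
      and fin: "(SUP z\<in>imag_axis. inv_norm (?X z)) < \<infinity>" "(SUP z\<in>imag_axis. (inv_norm (?X z))\<^sup>2) < \<infinity>"
    have \<epsilon>: "0 \<le> \<epsilon>" and A: "dim_row A = K"
      using sys by (auto simp: stable_balanced_system_def)
    have A_res: "inv_norm (z \<cdot>\<^sub>m 1\<^sub>m K - A) \<le> ereal (1 / \<rho>)" if "Re z = 0" for z
      using \<rho>(2) that unfolding pseudospectrum_def A by (auto simp: not_less)
    have le: "inv_norm (?X z) \<le> (SUP z\<in>imag_axis. inv_norm (?X z))"
      "(inv_norm (?X z))\<^sup>2 \<le> (SUP z\<in>imag_axis. (inv_norm (?X z))\<^sup>2)" if "Re z = 0" for z
      using that by (auto intro!: SUP_upper)
    show "(axis_norm (\<lambda>z. transfer (hna_A (Sigma1 K j1 j2 \<sigma>) (\<sigma> (k + 1)) (upper_left A ?n ?n) (upper_left B ?n m) (upper_left C p ?n) U)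
          (hna_B (Sigma1 K j1 j2 \<sigma>) (\<sigma> (k + 1)) (upper_left B ?n m) (upper_left C p ?n) U)
          (hna_C (Sigma1 K j1 j2 \<sigma>) (\<sigma> (k + 1)) (upper_left B ?n m) (upper_left C p ?n) U)
          (hna_D (\<sigma> (k + 1)) D U) z - transfer A B C D z))\<^sup>2
      \<le> ereal ((\<sigma> (k + 1))\<^sup>2) + ereal (mpoly_eval R (\<lambda>i. [spectral_norm A, spectral_norm B, spectral_norm C, \<sigma> 1,
            1 + spectral_norm (lower_right B ?n 0 + mat_adjoint (lower_right C 0 ?n) * U),
            1 + spectral_norm (1\<^sub>m p - U * mat_adjoint U)] ! i))
        * (ereal (1 / \<rho>) * (SUP z\<in>imag_axis. inv_norm (?X z))
             * ereal (\<epsilon> + spectral_norm (lower_right B ?n 0 + mat_adjoint (lower_right C 0 ?n) * U)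
                 + spectral_norm (1\<^sub>m p - U * mat_adjoint U))
           + (SUP z\<in>imag_axis. (inv_norm (?X z))\<^sup>2) * ereal (spectral_norm (1\<^sub>m p - U * mat_adjoint U))
           + ereal (1 / \<rho>\<^sup>2 * \<epsilon>))"
    proof (rule bound)
      fix xr x2r assume xr: "(SUP z\<in>imag_axis. inv_norm (?X z)) = ereal xr"
        "(SUP z\<in>imag_axis. (inv_norm (?X z))\<^sup>2) = ereal x2r"
      note balanced_system_error_bound[OF sys rK hna_U_carrier[OF U] A_res le[unfolded xr]]
      then show "(axis_norm (\<lambda>z. transfer (hna_A (Sigma1 K j1 j2 \<sigma>) (\<sigma> (k + 1)) (upper_left A ?n ?n) (upper_left B ?n m) (upper_left C p ?n) U)
          (hna_B (Sigma1 K j1 j2 \<sigma>) (\<sigma> (k + 1)) (upper_left B ?n m) (upper_left C p ?n) U)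
          (hna_C (Sigma1 K j1 j2 \<sigma>) (\<sigma> (k + 1)) (upper_left B ?n m) (upper_left C p ?n) U)
          (hna_D (\<sigma> (k + 1)) D U) z - transfer A B C D z))\<^sup>2 \<le> ereal ((\<sigma> (k + 1))\<^sup>2
        + 25 * ((1 + spectral_norm A)^4 * (1 + spectral_norm B)^4 * (1 + spectral_norm C)^4 * (1 + \<sigma> 1)^4
            * (1 + spectral_norm (1\<^sub>m p - U * mat_adjoint U))^4)
          * (1 / \<rho> * xr * (\<epsilon> + spectral_norm (lower_right B ?n 0 + mat_adjoint (lower_right C 0 ?n) * U)
                 + spectral_norm (1\<^sub>m p - U * mat_adjoint U))
             + x2r * spectral_norm (1\<^sub>m p - U * mat_adjoint U)))"
        by simp
    next
      show "0 \<le> (SUP z\<in>imag_axis. inv_norm (?X z))"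
        using order_trans[OF inv_norm_nonneg le(1)[of 0]] by simp
      have "0 \<le> (inv_norm (?X 0))\<^sup>2" by (simp add: power2_eq_square inv_norm_nonneg)
      then show "0 \<le> (SUP z\<in>imag_axis. (inv_norm (?X z))\<^sup>2)"
        using order_trans[OF _ le(2)[of 0]] by simp
    qed (use fin \<epsilon> \<rho> in simp_all)
  qed
qed

end
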